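(* Let $m\ge 0$ be an integer and let $f:\mathbb{C}\to\widehat{\mathbb{C}}$ be a transcendental meromorphic function in the class $\mathcal{B}$ for which $\infty$ is not a singular value (so all poles of $f$ are simple). Suppose that the poles of $f$ form a sequence $(a_j)$, ordered in such a way that $\dots\le |a_j|\le |a_{j+1}|\le\dots$, and let $b_j=\operatorname{Res}(f,a_j)$ be the residue of $f$ at $a_j$. Suppose furthermore that there is a constant $C\ge 1$ such that for all sufficiently large $j$ $$C^{-1} j^{2/(m+2)}\le |a_j|\le C\, j^{2/(m+2)}\quad\text{and}\quad C^{-1} j^{-m/(m+2)}\le |b_j|\le C\, j^{-m/(m+2)} .$$ Then the limit $\lim_{R\to\infty}\dim \mathcal{J}_R(f)$ exists and $$\dim \mathcal{I}(f)=\lim_{R\to\infty}\dim \mathcal{J}_R(f)=\frac{m+2}{m+4}.$$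
   Context: $\widehat{\mathbb{C}}=\mathbb{C}\cup\{\infty\}$ is the Riemann sphere. A meromorphic function on $\mathbb{C}$ is transcendental if it is not a rational function. A point $a\in\widehat{\mathbb{C}}$ is an asymptotic value of $f$ if there is a curve $\gamma:[0,\infty)\to\mathbb{C}$ with $\gamma(t)\to\infty$ and $f(\gamma(t))\to a$ as $t\to\infty$. A critical value is the image of a critical point (a point near which $f$, as a map to $\widehat{\mathbb{C}}$, is not injective); in particular $\infty$ is a critical value exactly when $f$ has a multiple pole. A singular value is a critical or asymptotic value. The class $\mathcal{B}$ (Eremenko–Lyubich class) consists of the meromorphic functions whose set of finite critical and asymptotic values is bounded in $\mathbb{C}$. $f^n$ denotes the $n$-th iterate of $f$ (with $f^0=\mathrm{id}$); $f^n(z)$ is defined for all $n$ exactly when no iterate $f^k(z)$ is a pole of $f$. The escaping set is $$\mathcal{I}(f)=\{z\in\mathbb{C}: f^n(z) \text{ is defined for all } n \text{ and } f^n(z)\to\infty \text{ as } n\to\infty\},$$ and for $R>0$, $$\mathcal{J}_R(f)=\{z\in\mathbb{C}: f^n(z)\text{ is defined and } |f^n(z)|>R \text{ for all } n\in\mathbb{N}=\{0,1,2,\dots\}\}.$$ $\dim A$ denotes the Hausdorff dimension of $A\subset\mathbb{C}$. *)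

theory Defs
  imports "HOL-Complex_Analysis.Complex_Analysis"
begin

text \<open>
  A meromorphic function on the plane is represented by some \<open>f :: complex \<Rightarrow> complex\<close> with
  \<open>f nicely_meromorphic_on UNIV\<close>: \<open>f\<close> is analytic except for poles, and carries the dummy value
  0 at its poles. The map into the Riemann sphere that it stands for is \<open>to_sphere f\<close>, where
  \<open>None\<close> is the point at infinity.
\<close>

abbreviation riemann_sphere :: "complex option topology" where
  "riemann_sphere \<equiv> Alexandroff_compactification euclidean"

definition to_sphere :: "(complex \<Rightarrow> complex) \<Rightarrow> complex \<Rightarrow> complex option" where
  "to_sphere f z = (if is_pole f z then None else Some (f z))"

(* The side condition on q is needed because of division by zero: at a zero of q the function
   may have a removable singularity of p / q. *)
definition rational_function :: "(complex \<Rightarrow> complex) \<Rightarrow> bool" where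
  "rational_function f \<longleftrightarrow>
     (\<exists>p q. q \<noteq> 0 \<and> (\<forall>z. poly q z \<noteq> 0 \<longrightarrow> f z = poly p z / poly q z))"

definition transcendental_meromorphic :: "(complex \<Rightarrow> complex) \<Rightarrow> bool" where
  "transcendental_meromorphic f \<longleftrightarrow> f nicely_meromorphic_on UNIV \<and> \<not> rational_function f"

definition asymptotic_value :: "(complex \<Rightarrow> complex) \<Rightarrow> complex option \<Rightarrow> bool" where
  "asymptotic_value f a \<longleftrightarrow>
     (\<exists>\<gamma> :: real \<Rightarrow> complex. continuous_on {0..} \<gamma> \<and> filterlim \<gamma> at_infinity at_top \<and>
        limitin riemann_sphere (\<lambda>t. to_sphere f (\<gamma> t)) a at_top)"

definition critical_point :: "(complex \<Rightarrow> complex) \<Rightarrow> complex \<Rightarrow> bool" where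
  "critical_point f z \<longleftrightarrow> (\<forall>U. open U \<and> z \<in> U \<longrightarrow> \<not> inj_on (to_sphere f) U)"

definition critical_value :: "(complex \<Rightarrow> complex) \<Rightarrow> complex option \<Rightarrow> bool" where
  "critical_value f a \<longleftrightarrow> (\<exists>z. critical_point f z \<and> to_sphere f z = a)"

definition singular_value :: "(complex \<Rightarrow> complex) \<Rightarrow> complex option \<Rightarrow> bool" where
  "singular_value f a \<longleftrightarrow> critical_value f a \<or> asymptotic_value f a"

definition eremenko_lyubich_class :: "(complex \<Rightarrow> complex) set" where
  "eremenko_lyubich_class =
     {f. f nicely_meromorphic_on UNIV \<and> bounded {w. singular_value f (Some w)}}"

(* The first pole met along the orbit of z is reached by genuine iterates, so the dummy values of
   f at poles play no role here; when the predicate holds, (f ^^ n) z is the true n-th iterate. *)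
definition orbit_defined :: "(complex \<Rightarrow> complex) \<Rightarrow> complex \<Rightarrow> bool" where
  "orbit_defined f z \<longleftrightarrow> (\<forall>k. \<not> is_pole f ((f ^^ k) z))"

definition escaping_set :: "(complex \<Rightarrow> complex) \<Rightarrow> complex set" where
  "escaping_set f =
     {z. orbit_defined f z \<and> filterlim (\<lambda>n. (f ^^ n) z) at_infinity sequentially}"

definition large_orbit_set :: "real \<Rightarrow> (complex \<Rightarrow> complex) \<Rightarrow> complex set" where
  "large_orbit_set R f = {z. orbit_defined f z \<and> (\<forall>n. norm ((f ^^ n) z) > R)}"

(* diam(U)^s with the conventions diam({})^s = 0 and 0^0 = 1 for nonempty U, so that the
   0-dimensional Hausdorff measure is counting measure; note that 0 powr 0 = 0. *)
definition diam_power :: "real \<Rightarrow> 'a::metric_space set \<Rightarrow> ennreal" where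
  "diam_power s U =
     (if U = {} then 0 else if s = 0 then 1 else ennreal (diameter U powr s))"

(* Boundedness is required explicitly because diameter is 0 on unbounded sets. *)
definition hausdorff_content :: "real \<Rightarrow> real \<Rightarrow> 'a::metric_space set \<Rightarrow> ennreal" where
  "hausdorff_content s \<delta> A =
     (INF U\<in>{U :: nat \<Rightarrow> 'a set. A \<subseteq> (\<Union>i. U i) \<and> (\<forall>i. bounded (U i) \<and> diameter (U i) \<le> \<delta>)}.
        (\<Sum>i. diam_power s (U i)))"

definition hausdorff_measure :: "real \<Rightarrow> 'a::metric_space set \<Rightarrow> ennreal" where
  "hausdorff_measure s A = (SUP \<delta>\<in>{0<..}. hausdorff_content s \<delta> A)"

definition hausdorff_dim :: "'a::metric_space set \<Rightarrow> ereal" where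
  "hausdorff_dim A = (INF s\<in>{s. 0 \<le> s \<and> hausdorff_measure s A = 0}. ereal s)"

end

theory Submission
  imports Defs "HOL-Real_Asymp.Real_Asymp"
begin

text \<open>
  Choose \<open>r0 > 0\<close> such that no singular value of \<open>f\<close> lies in \<open>{|w| > 1/r0} \<union> {\<infinity>}\<close>. The inverse branch of
  \<open>1/f\<close> that sends \<open>0\<close> to the pole \<open>a j\<close> then extends to a univalent function \<open>\<phi> j\<close> on the disc of
  radius \<open>r0\<close>, because an obstruction to continuation along a radius would be an asymptotic value.
  Moreover \<open>\<phi> j\<close> has derivative \<open>b j\<close> at \<open>0\<close>, so by a distortion theorem it scales distances by
  \<open>|b j|\<close>, up to a factor 2, on a smaller disc of universal relative size. An orbit that stays large
  therefore moves through the images \<open>D j\<close> of these small discs, and the branch of the inverse of \<open>f\<close> that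
  maps \<open>D k\<close> into \<open>D j\<close> contracts by a factor comparable to \<open>|b j| / |a k|\<^sup>2\<close>. Everything is governed by
  the series of the \<open>(|b k| / |a k|\<^sup>2) powr s\<close>, which behaves like the series of the
  \<open>k powr (- s * (m + 4) / (m + 2))\<close>.

  If the series converges, then for large \<open>R\<close> the contents \<open>x j\<close> of the pieces of the large orbit set
  satisfy \<open>x j \<le> (\<Sum>k. c j k * x k)\<close> with \<open>(\<Sum>k. c j k * |b k| powr s) \<le> |b j| powr s / 2\<close>, which forces
  them to vanish. If it diverges, finite blocks of indices with large sums yield a Cantor set of positive
  Hausdorff measure in the escaping set; the blocks have to move to infinity so slowly that the growth of the sums
  outweighs the possibly tiny gaps between poles of one block.
\<close>

section \<open>Hausdorff measure\<close>

lemma diam_power_empty [simp]: "diam_power s {} = 0"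
  by (simp add: diam_power_def)

lemma diam_power_pos_exponent: "s > 0 \<Longrightarrow> diam_power s U = ennreal (diameter U powr s)"
  by (simp add: diam_power_def diameter_def)

lemma hausdorff_content_le_cover:
  assumes "A \<subseteq> (\<Union>i. U i)" "\<And>i. bounded (U i)" "\<And>i. diameter (U i) \<le> \<delta>"
  shows "hausdorff_content s \<delta> A \<le> (\<Sum>i. diam_power s (U i))"
  unfolding hausdorff_content_def by (rule INF_lower) (use assms in auto)

lemma hausdorff_content_lessD:
  assumes "hausdorff_content s \<delta> A < c"
  obtains U :: "nat \<Rightarrow> 'a::metric_space set"
  where "A \<subseteq> (\<Union>i. U i)" "\<And>i. bounded (U i)" "\<And>i. diameter (U i) \<le> \<delta>"
    "(\<Sum>i. diam_power s (U i)) < c"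
  using assms unfolding hausdorff_content_def INF_less_iff by auto

lemma hausdorff_content_mono:
  assumes "A \<subseteq> B"
  shows "hausdorff_content s \<delta> A \<le> hausdorff_content s \<delta> B"
  unfolding hausdorff_content_def by (rule INF_superset_mono) (use assms in auto)

lemma hausdorff_content_le_measure:
  "\<delta> > 0 \<Longrightarrow> hausdorff_content s \<delta> A \<le> hausdorff_measure s A"
  unfolding hausdorff_measure_def by (rule SUP_upper) auto

lemma hausdorff_content_UN:
  fixes A :: "nat \<Rightarrow> 'a::metric_space set"
  shows "hausdorff_content s \<delta> (\<Union>i. A i) \<le> (\<Sum>i. hausdorff_content s \<delta> (A i))"
proof (rule ennreal_le_epsilon)
  fix e :: real
  assume fin: "(\<Sum>i. hausdorff_content s \<delta> (A i)) < top" and e: "0 < e"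
  have fin': "hausdorff_content s \<delta> (A i) < top" for i
    using fin by (metis ennreal_suminf_lessD)
  have "\<exists>U. A i \<subseteq> (\<Union>j. U j) \<and> (\<forall>j. bounded (U j) \<and> diameter (U j) \<le> \<delta>) \<and>
     (\<Sum>j. diam_power s (U j :: 'a set)) < hausdorff_content s \<delta> (A i) + ennreal (e * (1/2)^Suc i)" for i
  proof -
    have "hausdorff_content s \<delta> (A i) + 0 < hausdorff_content s \<delta> (A i) + ennreal (e * (1/2)^Suc i)"
      using fin'[of i] e by (subst ennreal_add_left_cancel_less) (auto simp: less_top)
    then have "hausdorff_content s \<delta> (A i) < hausdorff_content s \<delta> (A i) + ennreal (e * (1/2)^Suc i)"
      by simp
    then show ?thesis by (elim hausdorff_content_lessD) blast
  qed
  then obtain U where U: "\<And>i. A i \<subseteq> (\<Union>j. U i j)" "\<And>i j. bounded (U i j)"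
     "\<And>i j. diameter (U i j) \<le> \<delta>"
     "\<And>i. (\<Sum>j. diam_power s (U i j :: 'a set)) < hausdorff_content s \<delta> (A i) + ennreal (e * (1/2)^Suc i)"
    by metis
  have "hausdorff_content s \<delta> (\<Union>i. A i)
      \<le> (\<Sum>k. diam_power s (case_prod U (prod_decode k)))"
  proof (rule hausdorff_content_le_cover)
    show "(\<Union>i. A i) \<subseteq> (\<Union>k. case_prod U (prod_decode k))"
    proof
      fix x assume "x \<in> (\<Union>i. A i)"
      then obtain i j where "x \<in> U i j" using U(1) by blast
      then show "x \<in> (\<Union>k. case_prod U (prod_decode k))"
        by (intro UN_I[of "prod_encode (i, j)"]) auto
    qed
  qed (auto split: prod.split simp: U)
  also have "\<dots> = (\<Sum>i. \<Sum>j. diam_power s (U i j))"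
    by (rule suminf_ennreal_2dimen) auto
  also have "\<dots> \<le> (\<Sum>i. hausdorff_content s \<delta> (A i) + ennreal (e * (1/2)^Suc i))"
    by (intro suminf_le less_imp_le U(4)) auto
  also have "\<dots> = (\<Sum>i. hausdorff_content s \<delta> (A i)) + (\<Sum>i. ennreal (e * (1/2)^Suc i))"
    by (rule suminf_add[symmetric]) auto
  also have "(\<Sum>i. ennreal (e * (1/2)^Suc i)) = ennreal e"
  proof (rule suminf_ennreal_eq)
    show "(\<lambda>i. e * (1/2)^Suc i) sums e"
      using sums_mult[OF power_half_series, of e] by simp
  qed (use e in auto)
  finally show "hausdorff_content s \<delta> (\<Union>i. A i) \<le> (\<Sum>i. hausdorff_content s \<delta> (A i)) + ennreal e" .
qed

lemma hausdorff_content_le_diameter: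
  assumes "bounded A" "diameter A \<le> \<delta>" "s > 0"
  shows "hausdorff_content s \<delta> A \<le> ennreal (diameter A powr s)"
proof -
  have d: "\<delta> \<ge> 0" using assms diameter_ge_0 by fastforce
  have "hausdorff_content s \<delta> A \<le> (\<Sum>i. diam_power s (if i = (0::nat) then A else {}))"
    by (rule hausdorff_content_le_cover) (use assms d in auto)
  also have "\<dots> = diam_power s A"
    using suminf_finite[of "{0}" "\<lambda>i. diam_power s (if i = (0::nat) then A else {})"] by auto
  finally show ?thesis using assms by (simp add: diam_power_pos_exponent)
qed

text \<open>A cover of the image pulls back to a cover of \<open>A\<close> whose sets are at most
  \<open>L\<close> times as wide. Boundedness of the pulled-back sets needs its own argument, since
  \<open>diameter\<close> is \<open>0\<close> on unbounded sets.\<close>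

lemma hausdorff_content_expanding:
  fixes g :: "'a::metric_space \<Rightarrow> 'b::metric_space"
  assumes s: "s > 0" and L: "L > 0"
    and g: "\<And>x y. x \<in> A \<Longrightarrow> y \<in> A \<Longrightarrow> dist x y \<le> L * dist (g x) (g y)"
  shows "hausdorff_content s (L * \<delta>) A \<le> ennreal (L powr s) * hausdorff_content s \<delta> (g ` A)"
proof -
  define c where "c = ennreal (L powr s)"
  have c: "c \<noteq> 0" "c \<noteq> top" using L by (auto simp: c_def)
  \<comment> \<open>Dividing by \<open>c\<close> leaves the infimum alone on the right-hand side, so
    one cover can be treated at a time.\<close>
  have "hausdorff_content s (L * \<delta>) A / c \<le> hausdorff_content s \<delta> (g ` A)"
    unfolding hausdorff_content_def[of s \<delta> "g ` A"]
  proof (rule INF_greatest)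
    fix U :: "nat \<Rightarrow> 'b set"
    assume "U \<in> {U. g ` A \<subseteq> (\<Union>i. U i) \<and> (\<forall>i. bounded (U i) \<and> diameter (U i) \<le> \<delta>)}"
    then have U: "g ` A \<subseteq> (\<Union>i. U i)" "\<And>i. bounded (U i)" "\<And>i. diameter (U i) \<le> \<delta>" by auto
    define V where "V i = A \<inter> g -` U i" for i
    have V: "dist x y \<le> L * diameter (U i)" if "x \<in> V i" "y \<in> V i" for x y i
    proof -
      have "dist x y \<le> L * dist (g x) (g y)" using that g by (auto simp: V_def)
      also have "\<dots> \<le> L * diameter (U i)"
        using that L U by (intro mult_left_mono diameter_bounded_bound) (auto simp: V_def)
      finally show ?thesis .
    qed
    have bV: "bounded (V i)" for i
    proof (cases "V i = {}")
      case False
      then obtain x where "x \<in> V i" by auto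
      then show ?thesis unfolding bounded_def using V by blast
    qed auto
    have dV: "diameter (V i) \<le> L * diameter (U i)" for i
    proof (cases "V i = {}")
      case True then show ?thesis using L diameter_ge_0[OF U(2), of i] by simp
    next
      case False then show ?thesis using V unfolding diameter_def[of "V i"] by (auto intro!: cSUP_least)
    qed
    have "hausdorff_content s (L * \<delta>) A \<le> (\<Sum>i. diam_power s (V i))"
    proof (rule hausdorff_content_le_cover)
      show "A \<subseteq> (\<Union>i. V i)" using U(1) unfolding V_def by blast
      show "diameter (V i) \<le> L * \<delta>" for i
        using dV[of i] U(3)[of i] L by (meson mult_left_mono less_imp_le order_trans)
    qed (use bV in auto)
    also have "\<dots> \<le> (\<Sum>i. c * diam_power s (U i))"
    proof (intro suminf_le)
      fix i
      have "diameter (V i) powr s \<le> (L * diameter (U i)) powr s"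
        using dV bV s by (intro powr_mono2) (auto intro: diameter_ge_0)
      also have "\<dots> = L powr s * diameter (U i) powr s"
        by (rule powr_mult)
      finally show "diam_power s (V i) \<le> c * diam_power s (U i)"
        using s by (simp add: diam_power_pos_exponent c_def ennreal_mult'[symmetric])
    qed auto
    also have "\<dots> = c * (\<Sum>i. diam_power s (U i))" by simp
    finally show "hausdorff_content s (L * \<delta>) A / c \<le> (\<Sum>i. diam_power s (U i))"
      using c by (simp add: divide_le_posI_ennreal zero_less_iff_neq_zero mult.commute)
  qed
  then have "c * (hausdorff_content s (L * \<delta>) A / c) \<le> c * hausdorff_content s \<delta> (g ` A)"
    by (rule mult_left_mono) auto
  moreover have "c * (x / c) = x" for x
    using c by (metis ennreal_times_divide mult.commute mult_divide_eq_ennreal)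
  ultimately show ?thesis unfolding c_def by simp
qed

lemma hausdorff_content_antimono:
  assumes "\<delta> \<le> \<delta>'"
  shows "hausdorff_content s \<delta>' A \<le> hausdorff_content s \<delta> A"
  unfolding hausdorff_content_def by (rule INF_superset_mono) (use assms in \<open>auto intro: order_trans\<close>)

text \<open>For a positive exponent a small total weight forces every set of the cover to be small,
  so the scale does not matter for null sets. Later arguments can therefore work at one fixed
  scale.\<close>

lemma hausdorff_null_iff:
  assumes s: "s > 0" and \<delta>: "\<delta> > 0"
  shows "hausdorff_measure s A = 0 \<longleftrightarrow> hausdorff_content s \<delta> A = 0"
proof
  assume "hausdorff_measure s A = 0"
  then show "hausdorff_content s \<delta> A = 0"
    using hausdorff_content_le_measure[OF \<delta>, of s A] by simp
next
  assume 0: "hausdorff_content s \<delta> A = 0"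
  have "hausdorff_content s d A = 0" if d: "d > 0" for d
  proof -
    have "hausdorff_content s d A \<le> ennreal e" if e: "e > 0" for e
    proof -
      \<comment> \<open>The bound \<open>d powr s\<close> caps each summand and hence each diameter
        by \<open>d\<close>; the bound \<open>e\<close> caps the total.\<close>
      have "hausdorff_content s \<delta> A < ennreal (min e (d powr s))" using 0 d e by simp
      then obtain U where U: "A \<subseteq> (\<Union>i. U i)" "\<And>i. bounded (U i)"
        "(\<Sum>i. diam_power s (U i)) < ennreal (min e (d powr s))"
        by (rule hausdorff_content_lessD) auto
      have "diameter (U i) \<le> d" for i
      proof -
        have "diam_power s (U i) \<le> ennreal (min e (d powr s))"
          using U(3) by (metis ennreal_suminf_lessD less_imp_le)
        then have "diameter (U i) powr s \<le> d powr s"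
          using s e by (auto simp: diam_power_pos_exponent ennreal_le_iff2)
        then show ?thesis using s d by (meson not_le powr_less_mono2 less_imp_le)
      qed
      then have "hausdorff_content s d A \<le> (\<Sum>i. diam_power s (U i))"
        using U by (intro hausdorff_content_le_cover) auto
      also have "\<dots> \<le> ennreal e"
        using U(3) by (meson ennreal_leI less_imp_le min.cobounded1 order_trans)
      finally show ?thesis .
    qed
    then show ?thesis
      by (metis add.left_neutral ennreal_le_epsilon le_zero_eq)
  qed
  then show "hausdorff_measure s A = 0" by (simp add: hausdorff_measure_def)
qed

lemma hausdorff_null_subset:
  assumes "hausdorff_measure s B = 0" "A \<subseteq> B" "s > 0"
  shows "hausdorff_measure s A = 0"
  using assms hausdorff_content_mono[OF assms(2), of s 1] by (simp add: hausdorff_null_iff[of s 1])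

lemma hausdorff_null_UN:
  assumes "countable I" "\<And>i. i \<in> I \<Longrightarrow> hausdorff_measure s (A i) = 0" "s > 0"
  shows "hausdorff_measure s (\<Union>i\<in>I. A i) = 0"
proof (cases "I = {}")
  case True
  have "hausdorff_content s 1 ({} :: 'b set) \<le> ennreal (diameter ({} :: 'b set) powr s)"
    by (rule hausdorff_content_le_diameter) (use assms in auto)
  then show ?thesis using True assms by (simp add: hausdorff_null_iff[of s 1])
next
  case False
  have "hausdorff_content s 1 (\<Union>n. A (from_nat_into I n)) \<le> (\<Sum>n. hausdorff_content s 1 (A (from_nat_into I n)))"
    by (rule hausdorff_content_UN)
  also have "\<dots> = 0"
    proof -
    have "hausdorff_content s 1 (A (from_nat_into I n)) = 0" for n
      using assms(2)[OF from_nat_into[OF False]] by (simp only: hausdorff_null_iff[OF assms(3) zero_less_one])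
    then show ?thesis by simp
  qed
  also have "(\<Union>n. A (from_nat_into I n)) = (\<Union>i\<in>I. A i)"
  proof (intro equalityI UN_least)
    show "A (from_nat_into I n) \<subseteq> (\<Union>i\<in>I. A i)" for n
      by (rule UN_upper[OF from_nat_into[OF False]])
    fix i assume "i \<in> I"
    then obtain n where "from_nat_into I n = i" using from_nat_into_surj[OF assms(1)] by blast
    then show "A i \<subseteq> (\<Union>n. A (from_nat_into I n))" by (metis UN_upper UNIV_I)
  qed
  finally show ?thesis using assms by (simp add: hausdorff_null_iff[of s 1])
qed

lemma hausdorff_null_countable:
  assumes "countable A" "s > 0"
  shows "hausdorff_measure s A = 0"
proof -
  have "hausdorff_measure s {x} = 0" for x :: 'a
    using hausdorff_content_le_diameter[of "{x}" 1 s] assms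
    by (simp add: hausdorff_null_iff[of s 1])
  from hausdorff_null_UN[OF assms(1), of s "\<lambda>x. {x}", OF this assms(2)] show ?thesis by simp
qed

lemma hausdorff_null_expanding:
  assumes "hausdorff_measure s (g ` A) = 0" "s > 0" "L > 0"
    and "\<And>x y. x \<in> A \<Longrightarrow> y \<in> A \<Longrightarrow> dist x y \<le> L * dist (g x) (g y)"
  shows "hausdorff_measure s A = 0"
proof -
  have "hausdorff_content s (L * 1) A \<le> ennreal (L powr s) * hausdorff_content s 1 (g ` A)"
    by (rule hausdorff_content_expanding) (use assms in auto)
  then show ?thesis using assms
    by (simp add: hausdorff_null_iff[of s 1 "g ` A"] hausdorff_null_iff[of s L A])
qed

text \<open>At scale \<open>1\<close> all diameters are at most \<open>1\<close>, where powers
  decrease in the exponent. Equal exponents are split off because both could be \<open>0\<close>;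
  otherwise \<open>s'\<close> is positive and \<open>hausdorff_null_iff\<close> applies.\<close>

lemma hausdorff_null_exponent_mono:
  assumes "hausdorff_measure s A = 0" "0 \<le> s" "s \<le> s'"
  shows "hausdorff_measure s' A = 0"
proof (cases "s = s'")
  case False
  have "hausdorff_content s' 1 A \<le> hausdorff_content s 1 A"
    unfolding hausdorff_content_def
  proof (rule INF_mono)
    fix U :: "nat \<Rightarrow> 'a set" assume U: "U \<in> {U. A \<subseteq> (\<Union>i. U i) \<and> (\<forall>i. bounded (U i) \<and> diameter (U i) \<le> 1)}"
    have "diam_power s' (U i) \<le> diam_power s (U i)" for i
    proof -
      have "0 \<le> diameter (U i)" "diameter (U i) \<le> 1" using U diameter_ge_0 by auto
      moreover have "0 < s'" using assms False by auto
      ultimately show ?thesis using assms False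
        by (auto simp: diam_power_def powr_le1 intro!: ennreal_leI powr_mono')
    qed
    then show "\<exists>V\<in>{U. A \<subseteq> (\<Union>i. U i) \<and> (\<forall>i. bounded (U i) \<and> diameter (U i) \<le> 1)}.
       (\<Sum>i. diam_power s' (V i)) \<le> (\<Sum>i. diam_power s (U i))"
      using U by (intro bexI[of _ U] suminf_le) auto
  qed
  moreover have "hausdorff_content s 1 A = 0"
    using assms hausdorff_content_le_measure[of 1 s A] by simp
  ultimately show ?thesis using assms False by (simp add: hausdorff_null_iff[of s' 1])
qed (use assms in simp)

section \<open>From null sets to Hausdorff dimension\<close>

lemma hausdorff_dim_le:
  "0 \<le> s \<Longrightarrow> hausdorff_measure s A = 0 \<Longrightarrow> hausdorff_dim A \<le> ereal s"
  unfolding hausdorff_dim_def by (rule INF_lower) auto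

lemma hausdorff_dim_ge:
  assumes "\<And>s. 0 < s \<Longrightarrow> s < d \<Longrightarrow> hausdorff_measure s A \<noteq> 0"
  shows "ereal d \<le> hausdorff_dim A"
  unfolding hausdorff_dim_def
proof (rule INF_greatest)
  fix s assume s: "s \<in> {s. 0 \<le> s \<and> hausdorff_measure s A = 0}"
  show "ereal d \<le> ereal s"
  proof (rule ccontr)
    assume "\<not> ereal d \<le> ereal s"
    \<comment> \<open>The exponent \<open>s\<close> may be \<open>0\<close>, which the assumption
      does not cover; the midpoint with \<open>d\<close> is positive, and the measure still vanishes
      there.\<close>
    then have "s < (s + d) / 2" "(s + d) / 2 < d" by auto
    moreover have "hausdorff_measure ((s + d) / 2) A = 0"
      by (rule hausdorff_null_exponent_mono[of s]) (use s calculation in auto)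
    ultimately show False using assms[of "(s + d) / 2"] s by auto
  qed
qed

section \<open>Lower bounds from nested cells\<close>

text \<open>A geometric padding makes all weights strictly positive, even for cover sets of diameter
  \<open>0\<close>. The final contradiction in the next lemma rests on this positivity.\<close>

lemma hausdorff_null_weighted_cover:
  assumes "hausdorff_measure s A = 0" "s > 0" "e > 0"
  obtains U :: "nat \<Rightarrow> 'a::metric_space set" and t :: "nat \<Rightarrow> real"
  where "A \<subseteq> (\<Union>i. U i)" "\<And>i. t i > 0" "summable t" "suminf t < e"
    "\<And>i x y. x \<in> U i \<Longrightarrow> y \<in> U i \<Longrightarrow> dist x y powr s \<le> t i"
proof -
  have "hausdorff_content s 1 A < ennreal (e / 4)"
    using assms by (simp add: hausdorff_null_iff[of s 1])
  then obtain U where U: "A \<subseteq> (\<Union>i. U i)" "\<And>i. bounded (U i)"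
      "(\<Sum>i. diam_power s (U i)) < ennreal (e / 4)"
    by (rule hausdorff_content_lessD) blast
  define d where "d i = diameter (U i) powr s" for i
  have d0: "d i \<ge> 0" for i by (simp add: d_def)
  have sd: "(\<Sum>i. ennreal (d i)) < ennreal (e / 4)"
    using U(3) assms by (simp add: diam_power_pos_exponent d_def)
  have summ: "summable d"
    by (rule summable_suminf_not_top) (use d0 sd in auto)
  have sd': "suminf d < e / 4"
    using sd suminf_ennreal2[OF d0 summ] d0 summ by (simp add: ennreal_less_iff suminf_nonneg)
  \<comment> \<open>The powers of the diameters use less than \<open>e / 4\<close> and the padding
    uses \<open>e / 2\<close>, which together stay below \<open>e\<close>.\<close>
  define t where "t i = d i + e / 2 * (1/2)^Suc i" for i
  have h: "(\<lambda>i. e / 2 * (1/2)^Suc i) sums (e / 2)"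
    using sums_mult[OF power_half_series, of "e/2"] by simp
  have ts: "t sums (suminf d + e / 2)"
    unfolding t_def by (intro sums_add summable_sums summ h)
  show thesis
  proof (rule that[of U t])
    show "t i > 0" for i using d0[of i] assms by (auto simp: t_def add_nonneg_pos)
    show "summable t" using ts by (rule sums_summable)
    show "suminf t < e" using sums_unique[OF ts] sd' assms(3) by linarith
    fix i x y assume "x \<in> U i" "y \<in> U i"
    then have "dist x y powr s \<le> d i"
      using U(2) assms diameter_bounded_bound[of "U i" x y] by (auto simp: d_def intro!: powr_mono2)
    also have "\<dots> \<le> t i" using assms by (simp add: t_def)
    finally show "dist x y powr s \<le> t i" .
  qed (fact U(1))
qed

text \<open>
  Mass distribution without a measure: in a countable cover of total weight less than the value of a
  starting cell, no cover set can meet two children of a cell whose value exceeds the weight meeting it (they are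
  too far apart), so this weight inequality is inherited by some child. The point in the intersection of the resulting
  cells lies in a cover set of fixed weight, while the values of the cells tend to \<open>0\<close>.
\<close>
lemma hausdorff_measure_cells_nonzero:
  fixes f :: "'a::heine_borel \<Rightarrow> 'a" and G :: "nat \<Rightarrow> 'a \<Rightarrow> 'a" and D :: "nat \<Rightarrow> 'a set"
    and E :: "nat \<Rightarrow> nat set" and \<alpha> \<beta> \<gamma> v :: "nat \<Rightarrow> real"
  assumes s: "s > 0"
    and E: "\<And>n. finite (E n)" "\<And>n. E n \<noteq> {}"
    and D: "\<And>n j. j \<in> E n \<Longrightarrow> compact (D j)" "\<And>n j. j \<in> E n \<Longrightarrow> D j \<noteq> {}"
    and G: "\<And>n j k y. j \<in> E n \<Longrightarrow> k \<in> E (Suc n) \<Longrightarrow> y \<in> D k \<Longrightarrow> G j y \<in> D j \<and> f (G j y) = y"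
    and cont: "\<And>n j k. j \<in> E n \<Longrightarrow> k \<in> E (Suc n) \<Longrightarrow> continuous_on (D k) (G j)"
    and sep: "\<And>n j k l x y. j \<in> E n \<Longrightarrow> k \<in> E (Suc n) \<Longrightarrow> l \<in> E (Suc n) \<Longrightarrow> k \<noteq> l \<Longrightarrow>
        x \<in> D k \<Longrightarrow> y \<in> D l \<Longrightarrow> \<beta> j * \<gamma> n \<le> dist (G j x) (G j y)"
    and lip: "\<And>n j k x y. j \<in> E n \<Longrightarrow> k \<in> E (Suc n) \<Longrightarrow> x \<in> D k \<Longrightarrow> y \<in> D k \<Longrightarrow>
        \<beta> j * \<alpha> k * dist x y \<le> dist (G j x) (G j y)"
    and \<beta>: "\<And>n j. j \<in> E n \<Longrightarrow> 0 < \<beta> j \<and> \<beta> j \<le> B"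
    and \<alpha>: "\<And>n j k. j \<in> E n \<Longrightarrow> k \<in> E (Suc n) \<Longrightarrow> 0 < \<alpha> k \<and> \<beta> j * \<alpha> k \<le> 1 / 2"
    and v: "\<And>n. 0 < v n" "\<And>n. v n \<le> v 0" "\<And>n. v n \<le> \<gamma> n powr s" "\<And>n. 0 < \<gamma> n"
    and vsum: "\<And>n. v n \<le> v (Suc n) * (\<Sum>k\<in>E (Suc n). (\<alpha> k * \<beta> k) powr s)"
  shows "hausdorff_measure s {z. \<exists>w. \<forall>n. w n \<in> E n \<and> (f ^^ n) z \<in> D (w n)} \<noteq> 0"
    (is "hausdorff_measure s ?K \<noteq> 0")
proof
  assume null: "hausdorff_measure s ?K = 0"
  obtain j0 where j0: "j0 \<in> E 0" using E(2) by blast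
  have "0 < \<beta> j0 powr s * v 0" using \<beta>[OF j0] v(1) by auto
  from hausdorff_null_weighted_cover[OF null s this]
  obtain U t where U: "?K \<subseteq> (\<Union>i. U i)" and t: "\<And>i. t i > 0" "summable t"
     "suminf t < \<beta> j0 powr s * v 0"
     and Ut: "\<And>i x y. x \<in> U i \<Longrightarrow> y \<in> U i \<Longrightarrow> dist x y powr s \<le> t i"
    by blast
  define I where "I X = {i. U i \<inter> X \<noteq> {}}" for X
  \<comment> \<open>\<open>W\<close> replaces a mass: it is superadditive over sets no two of which
    meet a common cover set.\<close>
  define W where "W X = (\<Sum>i. if i \<in> I X then t i else 0)" for X
  have summ: "summable (\<lambda>i. if P i then t i else 0)" for P
    by (rule summable_comparison_test'[OF t(2), of 0]) (use t(1) in \<open>auto simp: less_imp_le\<close>)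
  have W_ge: "t i \<le> W X" if "i \<in> I X" for i X
  proof -
    have "(\<Sum>i\<in>{i}. if i \<in> I X then t i else 0) \<le> W X"
      unfolding W_def by (rule sum_le_suminf[OF summ]) (use t(1) in \<open>auto simp: less_imp_le\<close>)
    then show ?thesis using that by simp
  qed
  \<comment> \<open>The state of the descent at depth \<open>n\<close>: \<open>T\<close> is the
    composed inverse branch of the \<open>n\<close>-th iterate that carries \<open>D j\<close> onto
    the current cell, \<open>\<Lambda>\<close> bounds its scaling factor from below, and
    \<open>(\<Lambda> * \<beta> j) powr s * v n\<close> is the value of the cell.\<close>
  define P where "P n q \<longleftrightarrow> (case q of (j, T, \<Lambda>) \<Rightarrow>
      j \<in> E n \<and> 0 < \<Lambda> \<and> \<Lambda> \<le> (1/2)^n \<and> continuous_on (D j) T \<and>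
      (\<forall>x\<in>D j. (f ^^ n) (T x) = x) \<and> (\<forall>x\<in>D j. \<forall>y\<in>D j. \<Lambda> * dist x y \<le> dist (T x) (T y)) \<and>
      W (T ` D j) < (\<Lambda> * \<beta> j) powr s * v n)" for n and q :: "nat \<times> ('a \<Rightarrow> 'a) \<times> real"
  define X where "X = (\<lambda>(j, T :: 'a \<Rightarrow> 'a, \<Lambda>::real). T ` D j)"
  have "\<exists>q. \<forall>n. P n (q n) \<and> X (q (Suc n)) \<subseteq> X (q n)"
  proof (rule dependent_nat_choice)
    have "W (id ` D j0) \<le> suminf t"
      unfolding W_def by (intro suminf_le summ t(2)) (use t(1) in \<open>auto simp: less_imp_le\<close>)
    then have "P 0 (j0, id, 1)"
      using t(3) j0 by (auto simp: P_def)
    then show "\<exists>q. P 0 q" by blast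
  next
    fix q n assume "P n q"
    moreover obtain j T \<Lambda> where q: "q = (j, T, \<Lambda>)" by (cases q) auto
    ultimately have P: "j \<in> E n" "0 < \<Lambda>" "\<Lambda> \<le> (1/2)^n" "continuous_on (D j) T"
      "\<And>x. x \<in> D j \<Longrightarrow> (f ^^ n) (T x) = x"
      "\<And>x y. x \<in> D j \<Longrightarrow> y \<in> D j \<Longrightarrow> \<Lambda> * dist x y \<le> dist (T x) (T y)"
      "W (T ` D j) < (\<Lambda> * \<beta> j) powr s * v n"
      unfolding P_def by simp_all
    note \<beta>j = \<beta>[OF P(1)]
    define Y where "Y k = T ` G j ` D k" for k
    have Y: "Y k \<subseteq> T ` D j" if "k \<in> E (Suc n)" for k
      using G[OF P(1) that] by (auto simp: Y_def)
    \<comment> \<open>The images of two children are at least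
      \<open>\<Lambda> * \<beta> j * \<gamma> n\<close> apart, and
      \<open>v n \<le> \<gamma> n powr s\<close> turns this into a weight no smaller than the value
      of the parent.\<close>
    have disj: "k = l" if kl: "k \<in> E (Suc n)" "l \<in> E (Suc n)" and i: "i \<in> I (Y k)" "i \<in> I (Y l)" for k l i
    proof (rule ccontr)
      assume "k \<noteq> l"
      obtain x y where xy: "x \<in> D k" "y \<in> D l" "T (G j x) \<in> U i" "T (G j y) \<in> U i"
        using i by (auto simp: I_def Y_def)
      have "\<Lambda> * (\<beta> j * \<gamma> n) \<le> \<Lambda> * dist (G j x) (G j y)"
        by (intro mult_left_mono sep[OF P(1) kl \<open>k \<noteq> l\<close> xy(1,2)]) (use P in auto)
      also have "\<dots> \<le> dist (T (G j x)) (T (G j y))"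
        using P(6) G[OF P(1) kl(1) xy(1)] G[OF P(1) kl(2) xy(2)] by auto
      finally have "(\<Lambda> * (\<beta> j * \<gamma> n)) powr s \<le> dist (T (G j x)) (T (G j y)) powr s"
        using P \<beta>j v(4)[of n] s by (intro powr_mono2) auto
      also have "\<dots> \<le> t i" by (rule Ut) (use xy in auto)
      also have "\<dots> \<le> W (T ` D j)"
        using i(1) Y[OF kl(1)] by (intro W_ge) (auto simp: I_def)
      also have "\<dots> < (\<Lambda> * \<beta> j) powr s * v n" by (rule P)
      also have "\<dots> \<le> (\<Lambda> * \<beta> j) powr s * \<gamma> n powr s" by (intro mult_left_mono v) auto
      also have "\<dots> = (\<Lambda> * (\<beta> j * \<gamma> n)) powr s"
        using P \<beta>j v(4)[of n] by (subst powr_mult[symmetric]) (auto simp: mult_ac)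
      finally show False by simp
    qed
    \<comment> \<open>By \<open>vsum\<close> the values of the children add up to at least the value
      of the parent, so the strict inequality cannot fail for all of them.\<close>
    have "\<exists>k\<in>E (Suc n). W (Y k) < (\<Lambda> * \<beta> j * \<alpha> k * \<beta> k) powr s * v (Suc n)"
    proof (rule ccontr)
      assume "\<not> ?thesis"
      then have "(\<Sum>k\<in>E (Suc n). (\<Lambda> * \<beta> j * \<alpha> k * \<beta> k) powr s * v (Suc n)) \<le> (\<Sum>k\<in>E (Suc n). W (Y k))"
        by (intro sum_mono) auto
      also have "\<dots> = (\<Sum>i. \<Sum>k\<in>E (Suc n). if i \<in> I (Y k) then t i else 0)"
        unfolding W_def by (rule suminf_sum[symmetric]) (rule summ)
      also have "\<dots> \<le> W (T ` D j)"
        unfolding W_def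
      proof (intro suminf_le summ summable_sum)
        fix i
        show "(\<Sum>k\<in>E (Suc n). if i \<in> I (Y k) then t i else 0) \<le> (if i \<in> I (T ` D j) then t i else 0)"
        proof (cases "\<exists>k\<in>E (Suc n). i \<in> I (Y k)")
          case True
          then obtain k where k: "k \<in> E (Suc n)" "i \<in> I (Y k)" by blast
          have "(\<Sum>k\<in>E (Suc n). if i \<in> I (Y k) then t i else 0) = (\<Sum>l\<in>{k}. if i \<in> I (Y l) then t i else 0)"
            using k disj E(1) by (intro sum.mono_neutral_right) auto
          moreover have "i \<in> I (T ` D j)" using k Y[OF k(1)] by (auto simp: I_def)
          ultimately show ?thesis using k by simp
        next
          case False
          then have "(\<Sum>k\<in>E (Suc n). if i \<in> I (Y k) then t i else 0) = 0" by (intro sum.neutral) auto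
          then show ?thesis using t(1)[of i] by simp
        qed
      qed
      also have "\<dots> < (\<Lambda> * \<beta> j) powr s * v n" by (rule P)
      also have "\<dots> \<le> (\<Lambda> * \<beta> j) powr s * (v (Suc n) * (\<Sum>k\<in>E (Suc n). (\<alpha> k * \<beta> k) powr s))"
        by (intro mult_left_mono vsum) auto
      also have "\<dots> = (\<Sum>k\<in>E (Suc n). (\<Lambda> * \<beta> j * \<alpha> k * \<beta> k) powr s * v (Suc n))"
        unfolding sum_distrib_left
      proof (rule sum.cong)
        fix k assume k: "k \<in> E (Suc n)"
        have "(\<Lambda> * \<beta> j * \<alpha> k * \<beta> k) powr s = (\<Lambda> * \<beta> j) powr s * (\<alpha> k * \<beta> k) powr s"
          using P \<beta>j \<alpha>[OF P(1) k] \<beta>[OF k] by (subst powr_mult[symmetric]) (auto simp: mult_ac)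
        then show "(\<Lambda> * \<beta> j) powr s * (v (Suc n) * (\<alpha> k * \<beta> k) powr s) = (\<Lambda> * \<beta> j * \<alpha> k * \<beta> k) powr s * v (Suc n)"
          by simp
      qed simp
      finally show False by simp
    qed
    then obtain k where k: "k \<in> E (Suc n)" and Wk: "W (Y k) < (\<Lambda> * \<beta> j * \<alpha> k * \<beta> k) powr s * v (Suc n)"
      by blast
    note \<alpha>k = \<alpha>[OF P(1) k] and Gk = G[OF P(1) k]
    have "P (Suc n) (k, T \<circ> G j, \<Lambda> * \<beta> j * \<alpha> k)"
      unfolding P_def prod.case
    proof (intro conjI ballI)
      show "\<Lambda> * \<beta> j * \<alpha> k \<le> (1 / 2) ^ Suc n"
        using mult_mono[OF P(3), of "\<beta> j * \<alpha> k" "1/2"] \<alpha>k \<beta>j by (simp add: mult_ac)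
      show "continuous_on (D k) (T \<circ> G j)"
        using Gk by (intro continuous_on_compose cont[OF P(1) k] continuous_on_subset[OF P(4)]) auto
      show "(f ^^ Suc n) ((T \<circ> G j) x) = x" if "x \<in> D k" for x
        using P(5) Gk[OF that] by simp
      show "\<Lambda> * \<beta> j * \<alpha> k * dist x y \<le> dist ((T \<circ> G j) x) ((T \<circ> G j) y)" if "x \<in> D k" "y \<in> D k" for x y
      proof -
        have "\<Lambda> * (\<beta> j * \<alpha> k * dist x y) \<le> \<Lambda> * dist (G j x) (G j y)"
          by (intro mult_left_mono lip[OF P(1) k that]) (use P in auto)
        also have "\<dots> \<le> dist (T (G j x)) (T (G j y))"
          using P(6) Gk that by auto
        finally show ?thesis by (simp add: mult_ac)
      qed
      show "W ((T \<circ> G j) ` D k) < (\<Lambda> * \<beta> j * \<alpha> k * \<beta> k) powr s * v (Suc n)"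
        using Wk by (simp add: Y_def image_comp)
    qed (use k \<alpha>k \<beta>j P in auto)
    moreover have "X (k, T \<circ> G j, \<Lambda> * \<beta> j * \<alpha> k) \<subseteq> X q"
      using Y[OF k] by (auto simp: X_def q Y_def)
    ultimately show "\<exists>q'. P (Suc n) q' \<and> X q' \<subseteq> X q" by blast
  qed
  then obtain q where q: "\<And>n. P n (q n)" "\<And>n. X (q (Suc n)) \<subseteq> X (q n)" by blast
  define w T \<Lambda> where "w n = fst (q n)" and "T n = fst (snd (q n))" and "\<Lambda> n = snd (snd (q n))" for n
  have P: "w n \<in> E n" "0 < \<Lambda> n" "\<Lambda> n \<le> (1/2)^n" "continuous_on (D (w n)) (T n)"
      "\<And>x. x \<in> D (w n) \<Longrightarrow> (f ^^ n) (T n x) = x"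
      "W (T n ` D (w n)) < (\<Lambda> n * \<beta> (w n)) powr s * v n" for n
    using q(1)[of n] unfolding P_def w_def T_def \<Lambda>_def case_prod_beta by blast+
  have X: "X (q n) = T n ` D (w n)" for n by (simp add: X_def w_def T_def case_prod_beta)
  have "\<Inter>(range (\<lambda>n. X (q n))) \<noteq> {}"
  proof (rule compact_nest)
    show "compact (X (q n))" for n
      unfolding X by (intro compact_continuous_image P D(1)[OF P(1)])
    show "X (q n) \<noteq> {}" for n unfolding X using D(2)[OF P(1)] by auto
    show "X (q n) \<subseteq> X (q m)" if "m \<le> n" for m n
      using lift_Suc_antimono_le[of "\<lambda>n. X (q n)", OF q(2) that] .
  qed
  then obtain x where x: "\<And>n. x \<in> T n ` D (w n)" unfolding X by blast
  have "(f ^^ n) x \<in> D (w n)" for n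
    using x[of n] P(5)[of _ n] by auto
  then have "x \<in> ?K" using P(1) by auto
  then obtain i where i: "x \<in> U i" using U by blast
  have "t i \<le> ((1/2) powr s)^n * (B powr s * v 0)" for n
  proof -
    have \<beta>n: "0 < \<beta> (w n)" "\<beta> (w n) \<le> B" using \<beta>[OF P(1)] by auto
    have "t i \<le> W (T n ` D (w n))" using i x[of n] by (intro W_ge) (auto simp: I_def)
    also have "\<dots> \<le> (\<Lambda> n * \<beta> (w n)) powr s * v n" using P(6) by (rule less_imp_le)
    also have "\<dots> \<le> ((1/2)^n * B) powr s * v 0"
      using \<beta>n P(2,3)[of n] s v(1,2)[of n]
      by (intro mult_mono powr_mono2) auto
    also have "\<dots> = ((1/2) powr s)^n * (B powr s * v 0)"
      using \<beta>n by (simp add: powr_mult powr_power[symmetric] powr_powr mult_ac flip: powr_realpow)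
    finally show ?thesis .
  qed
  moreover have "(1/2::real) powr s < 1"
    using powr_less_mono2[OF s, of "1/2" 1] by simp
  then have "(\<lambda>n. ((1/2) powr s)^n * (B powr s * v 0)) \<longlonglongrightarrow> 0"
    by (intro tendsto_mult_left_zero LIMSEQ_power_zero) auto
  ultimately have "t i \<le> 0"
    by (intro LIMSEQ_le_const[of _ 0]) auto
  then show False using t(1)[of i] by simp
qed

section \<open>Distortion of univalent functions\<close>

text \<open>The function \<open>h z - b * z\<close> has derivative of norm at most
  \<open>norm b / 2\<close>, so by the mean value inequality \<open>h x - h y\<close> differs from
  \<open>b * (x - y)\<close> by at most half of the latter's norm. The upper factor
  \<open>3/2\<close> is relaxed to \<open>2\<close>.\<close>

lemma bilipschitz_of_deriv_near:
  fixes h :: "complex \<Rightarrow> complex"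
  assumes S: "convex S" and h: "\<And>z. z \<in> S \<Longrightarrow> (h has_field_derivative h' z) (at z within S)"
    and b: "\<And>z. z \<in> S \<Longrightarrow> norm (h' z - b) \<le> norm b / 2" and xy: "x \<in> S" "y \<in> S"
  shows "norm b / 2 * dist x y \<le> dist (h x) (h y)" "dist (h x) (h y) \<le> 2 * norm b * dist x y"
proof -
  have "norm ((h x - b * x) - (h y - b * y)) \<le> norm b / 2 * norm (x - y)"
    by (rule field_differentiable_bound[OF S _ b xy]) (auto intro!: derivative_eq_intros h)
  then have *: "norm ((h x - h y) - b * (x - y)) \<le> norm b / 2 * norm (x - y)"
    by (simp add: algebra_simps)
  have 1: "norm (b * (x - y)) \<le> norm (h x - h y) + norm ((h x - h y) - b * (x - y))"
    by (metis norm_triangle_sub norm_minus_commute)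
  have 2: "norm (h x - h y) \<le> norm (b * (x - y)) + norm ((h x - h y) - b * (x - y))"
    by (metis norm_triangle_sub)
  have 3: "0 \<le> norm b * norm (x - y)" by simp
  show "norm b / 2 * dist x y \<le> dist (h x) (h y)" "dist (h x) (h y) \<le> 2 * norm b * dist x y"
    using * 1 2 3 by (simp_all add: dist_norm norm_mult)
qed

text \<open>Otherwise the inverse of \<open>h\<close> would map the open unit disc into itself with
  fixed point \<open>0\<close> and derivative \<open>1\<close> there. By the Schwarz lemma it would
  be a rotation, which leaves no preimage in the open disc for the boundary value
  \<open>1\<close>.\<close>

lemma univalent_omits_closed_disc_value:
  assumes hol: "h holomorphic_on ball 0 1" and inj: "inj_on h (ball 0 1)"
    and h0: "h 0 = 0" and h1: "deriv h 0 = 1"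
  shows "\<exists>w. norm w \<le> 1 \<and> w \<notin> h ` ball 0 1"
proof (rule ccontr)
  assume "\<not> ?thesis"
  then have sub: "w \<in> h ` ball 0 1" if "norm w \<le> 1" for w using that by blast
  obtain g where g: "g holomorphic_on h ` ball 0 1"
     "\<And>z. z \<in> ball 0 1 \<Longrightarrow> deriv h z * deriv g (h z) = 1" "\<And>z. z \<in> ball 0 1 \<Longrightarrow> g (h z) = z"
    using holomorphic_has_inverse[OF hol open_ball inj] by metis
  have g0: "g 0 = 0" "deriv g 0 = 1" using g(2)[of 0] g(3)[of 0] h0 h1 by auto
  have hol': "g holomorphic_on ball 0 1"
    by (rule holomorphic_on_subset[OF g(1)]) (use sub in auto)
  have no: "norm (g w) < 1" if "norm w < 1" for w
    using sub[of w] that g(3) by auto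
  obtain \<alpha> where \<alpha>: "\<And>w. norm w < 1 \<Longrightarrow> g w = \<alpha> * w" "norm \<alpha> = 1"
    using Schwarz_Lemma(3)[OF hol' g0(1) no, of 0] g0(2) by auto
  \<comment> \<open>The point \<open>z / \<alpha>\<close> lies in the open disc and \<open>g\<close>
    sends it to \<open>z\<close>, so \<open>h z\<close> has norm below \<open>1\<close>, against
    \<open>h z = 1\<close>.\<close>
  obtain z where z: "norm z < 1" "h z = 1" using sub[of 1] by fastforce
  have nw: "norm (z / \<alpha>) < 1" using z \<alpha>(2) by (simp add: norm_divide)
  then obtain z' where z': "norm z' < 1" "h z' = z / \<alpha>" using sub[of "z / \<alpha>"] by fastforce
  have "z' = g (z / \<alpha>)" using g(3)[of z'] z' by simp
  also have "\<dots> = z" using \<alpha>(1)[OF nw] \<alpha>(2) by auto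
  finally show False using z z' nw by simp
qed

text \<open>The nested exponential is Schottky's bound at radius \<open>2/3\<close> for a function
  of norm at most \<open>1\<close> at the origin. Squaring it and adding \<open>1\<close> undoes the
  passage to a square root in the next lemma.\<close>

definition univalent_bound :: real where
  "univalent_bound = 1 + (exp (pi * exp (pi * (2 + 2 * 1 + 12 * (2/3) / (1 - 2/3)))))\<^sup>2"

text \<open>With \<open>w\<close> an omitted value, a square root \<open>g\<close> of \<open>1 - h / w\<close> with \<open>g 0 = 1\<close> omits
  \<open>0\<close> and \<open>-1\<close>, so Schottky's theorem applies to it.\<close>
lemma univalent_bounded:
  assumes hol: "h holomorphic_on ball 0 1" and inj: "inj_on h (ball 0 1)"
    and h0: "h 0 = 0" and h1: "deriv h 0 = 1" and z: "norm z \<le> 1/2"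
  shows "norm (h z) \<le> univalent_bound"
proof -
  obtain w where w: "norm w \<le> 1" "w \<notin> h ` ball 0 1"
    using univalent_omits_closed_disc_value[OF hol inj h0 h1] by blast
  have w0: "w \<noteq> 0" using w(2) h0 by (metis centre_in_ball image_eqI zero_less_one)
  have "(\<lambda>z. 1 - h z / w) holomorphic_on ball 0 1"
    by (intro holomorphic_intros hol) (use w0 in auto)
  moreover have "contractible (ball (0::complex) 1)" by (simp add: convex_imp_contractible)
  moreover have "1 - h z / w \<noteq> 0" if "z \<in> ball 0 1" for z
    using w(2) w0 that by (auto simp: field_simps)
  ultimately obtain g where g: "g holomorphic_on ball 0 1"
      "\<And>z. z \<in> ball 0 1 \<Longrightarrow> 1 - h z / w = g z ^ 2"
    using contractible_imp_holomorphic_sqrt[of "\<lambda>z. 1 - h z / w" "ball 0 1"] by blast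
  \<comment> \<open>Here \<open>g 0\<close> is \<open>1\<close> or \<open>-1\<close>, so the factor
    \<open>- g 0\<close> normalises \<open>G 0\<close> to \<open>-1\<close>, and \<open>G\<close>
    omits \<open>0\<close> and \<open>1\<close>. The factor \<open>3/4\<close> makes
    \<open>G\<close> holomorphic on the closed unit disc; a point with
    \<open>norm z \<le> 1/2\<close> corresponds to \<open>4/3 * z\<close> of norm at most
    \<open>2/3\<close>.\<close>
  define G where "G u = - (g 0) * g (3/4 * u)" for u
  have g0: "g 0 * g 0 = 1" using g(2)[of 0] h0 by (simp add: power2_eq_square)
  have gne: "g u \<noteq> 0" if "u \<in> ball 0 1" for u
    using g(2)[OF that] w(2) w0 that by (auto simp: field_simps)
  have "norm (G (4/3 * z)) \<le> exp (pi * exp (pi * (2 + 2 * 1 + 12 * (2/3) / (1 - 2/3))))"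
  proof (rule Schottky[where f = G and z = "4/3 * z" and r = 1 and t = "2/3"])
    show "G holomorphic_on cball 0 1" unfolding G_def
      by (intro holomorphic_intros holomorphic_on_compose_gen[OF _ g(1), unfolded o_def])
        (auto simp: norm_mult)
    have "norm (g 0) * norm (g 0) = 1" using g0 by (metis norm_mult norm_one)
    then show "norm (G 0) \<le> 1" by (simp add: G_def norm_mult)
    show "norm (4/3 * z) \<le> 2/3" using z by (simp add: norm_mult)
    fix u :: complex assume u: "u \<in> cball 0 1"
    then have u': "3/4 * u \<in> ball 0 1" by (simp add: norm_mult)
    show "\<not> (G u = 0 \<or> G u = 1)"
    proof (intro notI, elim disjE)
      assume "G u = 0" then show False using gne[OF u'] gne[of 0] by (simp add: G_def)
    next
      assume G1: "G u = 1"
      have "G u ^ 2 = (g 0 * g 0) * g (3/4 * u) ^ 2"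
        by (simp add: G_def power2_eq_square mult_ac)
      then have "g (3/4 * u) ^ 2 = 1" using g0 G1 by simp
      then have "h (3/4 * u) = h 0" using g(2)[OF u'] w0 h0 by (simp add: field_simps)
      then have "3/4 * u = 0" using inj_onD[OF inj _ u', of 0] by (metis centre_in_ball zero_less_one)
      then show False using G1 g0 by (auto simp: G_def)
    qed
  qed auto
  moreover have "norm (G (4/3 * z)) = norm (g z)"
  proof -
    have "norm (g 0) ^ 2 = 1" using g0 by (metis norm_mult norm_one power2_eq_square)
    then have "norm (g 0) = 1" by (metis norm_ge_zero one_power2 power2_eq_iff_nonneg zero_le_one)
    then show ?thesis by (simp add: G_def norm_mult)
  qed
  ultimately have gb: "norm (g z) ^ 2 \<le> (exp (pi * exp (pi * (2 + 2 * 1 + 12 * (2/3) / (1 - 2/3)))))\<^sup>2"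
    by (intro power_mono) auto
  have "h z = w * (1 - g z ^ 2)"
    using g(2)[of z] z w0 by (simp add: field_simps)
  then have "norm (h z) \<le> 1 * norm (1 - g z ^ 2)"
    using w(1) by (simp add: norm_mult mult_left_le_one_le)
  also have "\<dots> \<le> 1 + norm (g z) ^ 2"
    using norm_triangle_ineq4[of 1 "g z ^ 2"] by (simp add: norm_power)
  finally show ?thesis using gb unfolding univalent_bound_def by linarith
qed

text \<open>Cauchy's inequality on discs of radius \<open>1/4\<close> inside the disc of radius
  \<open>1/2\<close> bounds the second derivative by \<open>2 * univalent_bound / (1/4)^2\<close>;
  integrating gives the claim.\<close>

lemma univalent_deriv_near_1:
  assumes hol: "h holomorphic_on ball 0 1" and inj: "inj_on h (ball 0 1)"
    and h0: "h 0 = 0" and h1: "deriv h 0 = 1" and z: "norm z \<le> 1/4"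
  shows "norm (deriv h z - 1) \<le> 32 * univalent_bound * norm z"
proof -
  have hol': "deriv h holomorphic_on ball 0 1" by (intro holomorphic_deriv hol open_ball)
  have "norm (deriv h z - deriv h 0) \<le> 32 * univalent_bound * norm (z - 0)"
  proof (rule field_differentiable_bound[where S = "cball 0 (1/4)" and f' = "deriv (deriv h)"])
    fix x :: complex assume x: "x \<in> cball 0 (1/4)"
    show "(deriv h has_field_derivative deriv (deriv h) x) (at x within cball 0 (1/4))"
      by (rule has_field_derivative_at_within, rule holomorphic_derivI[OF hol' open_ball]) (use x in auto)
    have sub: "cball x (1/4) \<subseteq> cball 0 (1/2)"
      using x by (simp add: cball_subset_cball_iff dist_norm)
    also have "\<dots> \<subseteq> ball 0 1" by (simp add: cball_subset_ball_iff)
    finally have "norm ((deriv ^^ 2) h x) \<le> fact 2 * univalent_bound / (1/4) ^ 2"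
    proof (intro Cauchy_inequality)
      assume *: "cball x (1/4) \<subseteq> ball 0 1"
      show "h holomorphic_on ball x (1/4)"
        by (rule holomorphic_on_subset[OF hol]) (use * ball_subset_cball in blast)
      show "continuous_on (cball x (1/4)) h"
        by (intro holomorphic_on_imp_continuous_on holomorphic_on_subset[OF hol] *)
      fix y assume "norm (x - y) = 1/4"
      then have "y \<in> cball x (1/4)" by (simp add: dist_norm)
      then have "norm y \<le> 1/2" using sub by auto
      then show "norm (h y) \<le> univalent_bound" by (intro univalent_bounded hol inj h0 h1)
    qed auto
    then show "norm (deriv (deriv h) x) \<le> 32 * univalent_bound"
      by (simp add: numeral_2_eq_2)
  qed (use z in auto)
  then show ?thesis by (simp add: h1)
qed

text \<open>After affine normalisation to the unit disc, the derivative stays close to its value at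
  the centre on a disc of relative size \<open>\<epsilon>\<close>. Since \<open>\<epsilon>\<close>
  depends neither on \<open>\<phi>\<close> nor on \<open>r\<close>, the estimate is uniform over all
  poles.\<close>

lemma univalent_bilipschitz:
  obtains \<epsilon> :: real where "0 < \<epsilon>" "\<epsilon> \<le> 1/4"
    "\<And>\<phi> r u v. r > 0 \<Longrightarrow> \<phi> holomorphic_on ball 0 r \<Longrightarrow> inj_on \<phi> (ball 0 r) \<Longrightarrow>
       norm u \<le> \<epsilon> * r \<Longrightarrow> norm v \<le> \<epsilon> * r \<Longrightarrow>
       norm (deriv \<phi> 0) / 2 * dist u v \<le> dist (\<phi> u) (\<phi> v) \<and>
       dist (\<phi> u) (\<phi> v) \<le> 2 * norm (deriv \<phi> 0) * dist u v"
proof -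
  have M: "univalent_bound \<ge> 1" by (simp add: univalent_bound_def)
  \<comment> \<open>This choice makes \<open>32 * univalent_bound * \<epsilon>\<close> equal to
    \<open>1/2\<close>, the deviation allowed in \<open>bilipschitz_of_deriv_near\<close>.\<close>
  define \<epsilon> where "\<epsilon> = 1 / (64 * univalent_bound)"
  have \<epsilon>: "0 < \<epsilon>" "\<epsilon> \<le> 1/4" using M by (auto simp: \<epsilon>_def field_simps)
  show thesis
  proof (rule that[OF \<epsilon>])
    fix \<phi> :: "complex \<Rightarrow> complex" and r :: real and u v :: complex
    assume r: "r > 0" and hol: "\<phi> holomorphic_on ball 0 r" and inj: "inj_on \<phi> (ball 0 r)"
      and uv: "norm u \<le> \<epsilon> * r" "norm v \<le> \<epsilon> * r"
    define b where "b = deriv \<phi> 0"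
    have b: "b \<noteq> 0" unfolding b_def
      by (rule holomorphic_injective_imp_regular[OF hol open_ball inj]) (use r in auto)
    define h where "h z = (\<phi> (of_real r * z) - \<phi> 0) / (of_real r * b)" for z
    have dh: "(h has_field_derivative deriv \<phi> (of_real r * z) / b) (at z)" if "z \<in> ball 0 1" for z
    proof -
      have "of_real r * z \<in> ball 0 r" using that r by (simp add: norm_mult)
      then have "(\<phi> has_field_derivative deriv \<phi> (of_real r * z)) (at (of_real r * z))"
        by (rule holomorphic_derivI[OF hol open_ball])
      from DERIV_chain2[where g = "\<lambda>z. of_real r * z" and x = z and Db = "of_real r" and s = UNIV, OF this]
      have "((\<lambda>z. \<phi> (of_real r * z)) has_field_derivative deriv \<phi> (of_real r * z) * of_real r) (at z)"
        by (auto intro!: derivative_eq_intros)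
      then show ?thesis unfolding h_def using r b
        by (auto intro!: derivative_eq_intros simp: field_simps)
    qed
    have holh: "h holomorphic_on ball 0 1"
      using dh by (meson holomorphic_on_open open_ball)
    have injh: "inj_on h (ball 0 1)"
    proof (rule inj_onI)
      fix x y :: complex assume xy: "x \<in> ball 0 1" "y \<in> ball 0 1" "h x = h y"
      then have "\<phi> (of_real r * x) = \<phi> (of_real r * y)" using r b by (simp add: h_def)
      moreover have "of_real r * x \<in> ball 0 r" "of_real r * y \<in> ball 0 r"
        using xy r by (auto simp: norm_mult)
      ultimately have "of_real r * x = of_real r * y" using inj by (auto dest: inj_onD)
      then show "x = y" using r by simp
    qed
    have h0: "h 0 = 0" by (simp add: h_def)
    have h1: "deriv h 0 = 1"
      using DERIV_imp_deriv[OF dh[of 0]] b by (simp add: b_def)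
    have near: "norm (deriv \<phi> z - b) \<le> norm b / 2" if z: "z \<in> cball 0 (\<epsilon> * r)" for z
    proof -
      have nz: "norm (z / of_real r) \<le> \<epsilon>" using z r by (simp add: norm_divide field_simps)
      then have "z / of_real r \<in> ball 0 1" using \<epsilon> by simp
      from DERIV_imp_deriv[OF dh[OF this]] have "deriv h (z / of_real r) = deriv \<phi> z / b"
        using r by simp
      moreover have "norm (deriv h (z / of_real r) - 1) \<le> 32 * univalent_bound * norm (z / of_real r)"
        by (rule univalent_deriv_near_1[OF holh injh h0 h1]) (use nz \<epsilon> in linarith)
      moreover have "32 * univalent_bound * norm (z / of_real r) \<le> 32 * univalent_bound * \<epsilon>"
        using nz M by (intro mult_left_mono) auto
      moreover have "32 * univalent_bound * \<epsilon> = 1/2" using M by (simp add: \<epsilon>_def)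
      ultimately have "norm (deriv \<phi> z / b - 1) \<le> 1/2" by simp
      moreover have "deriv \<phi> z - b = b * (deriv \<phi> z / b - 1)" using b by (simp add: field_simps)
      then have "norm (deriv \<phi> z - b) = norm b * norm (deriv \<phi> z / b - 1)" by (simp add: norm_mult)
      ultimately show ?thesis
        using mult_left_mono[of "norm (deriv \<phi> z / b - 1)" "1/2" "norm b"] by simp
    qed
    have er: "\<epsilon> * r < r" using \<epsilon> r by simp
    have der: "(\<phi> has_field_derivative deriv \<phi> z) (at z within cball 0 (\<epsilon> * r))"
      if "z \<in> cball 0 (\<epsilon> * r)" for z
      by (rule has_field_derivative_at_within, rule holomorphic_derivI[OF hol open_ball]) (use that er in auto)
    have uv': "u \<in> cball 0 (\<epsilon> * r)" "v \<in> cball 0 (\<epsilon> * r)" using uv by auto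
    show "norm (deriv \<phi> 0) / 2 * dist u v \<le> dist (\<phi> u) (\<phi> v) \<and>
       dist (\<phi> u) (\<phi> v) \<le> 2 * norm (deriv \<phi> 0) * dist u v"
      using bilipschitz_of_deriv_near[OF convex_cball der near uv'] by (simp add: b_def)
  qed
qed

section \<open>Inverse branches over a disc without singular values\<close>

locale no_large_singular_values =
  fixes f :: "complex \<Rightarrow> complex" and r0 :: real
  assumes mero: "f nicely_meromorphic_on UNIV" and r0: "r0 > 0"
    and no_sing: "\<And>w. norm w > 1 / r0 \<Longrightarrow> \<not> singular_value f (Some w)"
    and no_sing_inf: "\<not> singular_value f None"
begin

text \<open>Since \<open>f\<close> carries the value \<open>0\<close> at its poles and \<open>inverse 0 = 0\<close>, this is \<open>1/f\<close> at the poles as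
  well; the junk value at the zeros of \<open>f\<close> lies outside \<open>\<Omega>\<close>.\<close>
definition F :: "complex \<Rightarrow> complex" where "F z = inverse (f z)"

text \<open>In the coordinate \<open>1/w\<close> on the sphere this is the full preimage of
  \<open>ball 0 r0\<close>; zeros of \<open>f\<close>, where \<open>F\<close> is \<open>0\<close> as
  well, are kept out.\<close>

definition \<Omega> :: "complex set" where "\<Omega> = {z. is_pole f z \<or> norm (f z) > 1 / r0}"

lemma pole_zero: "is_pole f z \<Longrightarrow> f z = 0"
  using is_pole_zero_at_nicely_mero[OF mero] by auto

lemma F_pole: "is_pole f z \<Longrightarrow> F z = 0"
  by (simp add: F_def pole_zero)

lemma F_eq_0_iff: "z \<in> \<Omega> \<Longrightarrow> F z = 0 \<longleftrightarrow> is_pole f z"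
  using r0 by (auto simp: \<Omega>_def F_def pole_zero)

lemma analytic_at_nonpole: "\<not> is_pole f z \<Longrightarrow> f analytic_on {z}"
  using nicely_meromorphic_on_imp_analytic_at[OF mero] by auto

lemma open_nonpoles: "open {z. \<not> is_pole f z}"
proof (subst open_subopen, safe)
  fix z assume "\<not> is_pole f z"
  then obtain S where "open S" "z \<in> S" "f analytic_on S"
    using analytic_at_nonpole analytic_at analytic_on_open by metis
  then show "\<exists>T. open T \<and> z \<in> T \<and> T \<subseteq> {z. \<not> is_pole f z}"
    by (intro exI[of _ S]) (use analytic_at_imp_no_pole analytic_on_subset in blast)
qed

lemma holomorphic_nonpoles: "f holomorphic_on {z. \<not> is_pole f z}"
  using analytic_at_nonpole analytic_imp_holomorphic analytic_on_analytic_at by blast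

lemma norm_F_less: "z \<in> \<Omega> \<Longrightarrow> norm (F z) < r0"
proof (cases "is_pole f z")
  case False
  assume "z \<in> \<Omega>"
  then have "norm (f z) > 1 / r0" using False by (simp add: \<Omega>_def)
  then show ?thesis
    using less_imp_inverse_less[of "1 / r0" "norm (f z)"] r0 by (simp add: F_def norm_inverse)
qed (use r0 F_pole in auto)

text \<open>At a pole the removable singularity of \<open>1/f\<close> is filled by the value
  \<open>0\<close> that \<open>F\<close> has there; elsewhere continuity of \<open>f\<close> is
  enough.\<close>

lemma local_\<Omega>:
  assumes z: "z \<in> \<Omega>"
  obtains S where "open S" "z \<in> S" "S \<subseteq> \<Omega>" "F holomorphic_on S" "\<forall>w\<in>S - {z}. \<not> is_pole f w"
proof (cases "is_pole f z")
  case False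
  define S where "S = {w \<in> {w. \<not> is_pole f w}. norm (f w) \<in> {1/r0<..}}"
  have "continuous_on {w. \<not> is_pole f w} (\<lambda>w. norm (f w))"
    using holomorphic_on_imp_continuous_on[OF holomorphic_nonpoles] by (intro continuous_intros)
  from continuous_on_open_vimage[OF open_nonpoles] this open_greaterThan
  have "open ((\<lambda>w. norm (f w)) -` {1/r0<..} \<inter> {w. \<not> is_pole f w})" by blast
  moreover have "(\<lambda>w. norm (f w)) -` {1/r0<..} \<inter> {w. \<not> is_pole f w} = S"
    by (auto simp: S_def)
  ultimately have "open S" by simp
  moreover have "F holomorphic_on S"
    unfolding F_def using r0
    by (intro holomorphic_intros holomorphic_on_subset[OF holomorphic_nonpoles])
      (auto simp: S_def dest: less_trans[of 0 "1/r0"])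
  moreover have "z \<in> S" "S \<subseteq> \<Omega>" using z False by (auto simp: S_def \<Omega>_def)
  moreover have "\<forall>w\<in>S - {z}. \<not> is_pole f w" by (simp add: S_def)
  ultimately show ?thesis using that[of S] by blast
next
  case True
  then have lim: "filterlim f at_infinity (at z)" by (simp add: is_pole_def)
  then have "eventually (\<lambda>w. norm (f w) \<ge> 1 / r0 + 1) (at z)"
    using r0 by (simp add: filterlim_at_infinity[of 0] add_pos_pos)
  then obtain d where d: "d > 0" "\<And>w. w \<noteq> z \<Longrightarrow> dist w z < d \<Longrightarrow> norm (f w) \<ge> 1/r0 + 1"
    by (auto simp: eventually_at)
  \<comment> \<open>At a second pole \<open>f\<close> would carry the dummy value \<open>0\<close>,
    against the lower bound on \<open>f\<close> in the disc.\<close>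
  have np: "\<not> is_pole f w" if "w \<in> ball z d - {z}" for w
  proof
    assume "is_pole f w"
    then have "f w = 0" by (rule pole_zero)
    moreover have "norm (f w) \<ge> 1/r0 + 1" using that by (intro d) (auto simp: dist_commute)
    moreover have "1/r0 > 0" using r0 by simp
    ultimately show False by simp
  qed
  have "(\<lambda>x. if x = z then 0 else inverse (f x)) holomorphic_on ball z d"
  proof (rule is_pole_inverse_holomorphic)
    show "f holomorphic_on ball z d - {z}"
      by (rule holomorphic_on_subset[OF holomorphic_nonpoles]) (use np in auto)
    show "\<forall>x\<in>ball z d - {z}. f x \<noteq> 0"
    proof
      fix x assume "x \<in> ball z d - {z}"
      then have "norm (f x) \<ge> 1/r0 + 1" by (intro d) (auto simp: dist_commute)
      moreover have "1/r0 > 0" using r0 by simp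
      ultimately have "norm (f x) > 0" by linarith
      then show "f x \<noteq> 0" by simp
    qed
  qed (use True in auto)
  also have "(\<lambda>x. if x = z then 0 else inverse (f x)) = F"
    using pole_zero[OF True] by (auto simp: F_def fun_eq_iff)
  finally have "F holomorphic_on ball z d" .
  moreover have "ball z d \<subseteq> \<Omega>"
  proof
    fix w assume w: "w \<in> ball z d"
    show "w \<in> \<Omega>"
    proof (cases "w = z")
      case False
      then have "norm (f w) \<ge> 1/r0 + 1" using w by (intro d) (auto simp: dist_commute)
      then show ?thesis by (simp add: \<Omega>_def)
    qed (use True in \<open>simp add: \<Omega>_def\<close>)
  qed
  ultimately show ?thesis using that[of "ball z d"] np d(1) by auto
qed

lemma open_\<Omega>: "open \<Omega>"
  by (subst open_subopen) (meson local_\<Omega>)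

lemma holomorphic_F: "F holomorphic_on \<Omega>"
proof -
  let ?U = "{S. open S \<and> S \<subseteq> \<Omega> \<and> F holomorphic_on S}"
  have "F holomorphic_on (\<Union>S\<in>?U. S)" by (rule holomorphic_on_UN_open) auto
  moreover have "\<Omega> \<subseteq> (\<Union>S\<in>?U. S)"
  proof
    fix z assume "z \<in> \<Omega>"
    then obtain S where "open S" "z \<in> S" "S \<subseteq> \<Omega>" "F holomorphic_on S" by (rule local_\<Omega>)
    then show "z \<in> (\<Union>S\<in>?U. S)" by blast
  qed
  ultimately show ?thesis by (rule holomorphic_on_subset)
qed

lemma isCont_F: "z \<in> \<Omega> \<Longrightarrow> isCont F z"
  using holomorphic_F open_\<Omega> continuous_on_eq_continuous_at holomorphic_on_imp_continuous_on by blast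

lemma not_singular:
  assumes "z \<in> \<Omega>" shows "\<not> singular_value f (to_sphere f z)"
  using assms no_sing no_sing_inf by (auto simp: \<Omega>_def to_sphere_def)

text \<open>A critical point in \<open>\<Omega>\<close> would produce a singular value near
  infinity. So the map to the sphere is locally injective, and on \<open>\<Omega>\<close> it can be
  recovered from \<open>F\<close>.\<close>

lemma F_locally_injective:
  assumes z: "z \<in> \<Omega>"
  obtains V where "open V" "z \<in> V" "V \<subseteq> \<Omega>" "inj_on F V"
proof -
  have "\<not> critical_point f z"
    using not_singular[OF z] by (auto simp: singular_value_def critical_value_def)
  then obtain U where U: "open U" "z \<in> U" "inj_on (to_sphere f) U"
    by (auto simp: critical_point_def)
  have "inj_on F (U \<inter> \<Omega>)"
  proof (rule inj_onI)
    fix x y assume xy: "x \<in> U \<inter> \<Omega>" "y \<in> U \<inter> \<Omega>" "F x = F y"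
    then have "is_pole f x \<longleftrightarrow> is_pole f y" using F_eq_0_iff[of x] F_eq_0_iff[of y] by simp
    then have "to_sphere f x = to_sphere f y"
      using xy(3) by (auto simp: to_sphere_def F_def)
    then show "x = y" using U(3) xy by (auto dest: inj_onD)
  qed
  then show ?thesis using that[of "U \<inter> \<Omega>"] U open_\<Omega> z by auto
qed

section \<open>Sections of \<open>F\<close>, that is, inverse branches of \<open>1/f\<close>:
  existence, uniqueness, gluing\<close>

definition sect :: "complex set \<Rightarrow> (complex \<Rightarrow> complex) \<Rightarrow> bool" where
  "sect S \<phi> \<longleftrightarrow> \<phi> holomorphic_on S \<and> (\<forall>u\<in>S. \<phi> u \<in> \<Omega> \<and> F (\<phi> u) = u)"

lemma sect_subset: "sect S \<phi> \<Longrightarrow> T \<subseteq> S \<Longrightarrow> sect T \<phi>"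
  unfolding sect_def using holomorphic_on_subset by blast

text \<open>The neighbourhood \<open>V\<close> turns the local inverse into a test: any section
  agrees with \<open>\<psi>\<close> wherever it takes values in \<open>V\<close>.\<close>

lemma local_sect:
  assumes z: "z \<in> \<Omega>"
  obtains e \<psi> V where "e > 0" "sect (ball (F z) e) \<psi>" "\<psi> (F z) = z" "open V" "z \<in> V"
    "\<And>x. x \<in> V \<Longrightarrow> F x \<in> ball (F z) e \<and> \<psi> (F x) = x"
proof -
  obtain V0 where V0: "open V0" "z \<in> V0" "V0 \<subseteq> \<Omega>" "inj_on F V0"
    using F_locally_injective[OF z] by blast
  have hol: "F holomorphic_on V0" using V0 holomorphic_F holomorphic_on_subset by blast
  obtain g where g: "g holomorphic_on F ` V0" "\<And>z. z \<in> V0 \<Longrightarrow> g (F z) = z"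
    using holomorphic_has_inverse[OF hol V0(1,4)] by metis
  have "open (F ` V0)" by (rule open_mapping_thm3[OF hol V0(1,4)])
  then obtain e where e: "e > 0" "ball (F z) e \<subseteq> F ` V0" using V0(2) openE by blast
  have "sect (ball (F z) e) g"
    unfolding sect_def using holomorphic_on_subset[OF g(1) e(2)] e(2) g(2) V0(3) by fastforce
  moreover have "open (F -` ball (F z) e \<inter> V0)"
    using continuous_on_open_vimage[OF V0(1)] holomorphic_on_imp_continuous_on[OF hol] by blast
  ultimately show ?thesis
    using that[of e g "F -` ball (F z) e \<inter> V0"] e(1) g(2) V0(2) by auto
qed

text \<open>Near \<open>u\<close> both sections take values close to the common value
  \<open>\<phi> u\<close>, where \<open>F\<close> has a single local inverse; the identity theorem
  spreads the agreement.\<close>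

lemma sect_unique:
  assumes S: "open S" "connected S" and \<phi>: "sect S \<phi>" and \<psi>: "sect S \<psi>"
    and u: "u \<in> S" "\<phi> u = \<psi> u" and v: "v \<in> S"
  shows "\<phi> v = \<psi> v"
proof -
  obtain e g V where V: "open V" "\<phi> u \<in> V" "\<And>x. x \<in> V \<Longrightarrow> g (F x) = x"
    using local_sect[of "\<phi> u"] \<phi> u(1) by (metis sect_def)
  define T where "T = S \<inter> \<phi> -` V \<inter> \<psi> -` V"
  have "open (\<phi> -` V \<inter> S)" "open (\<psi> -` V \<inter> S)"
    using continuous_on_open_vimage[OF S(1)] V(1) \<phi> \<psi> holomorphic_on_imp_continuous_on
    unfolding sect_def by blast+
  from open_Int[OF this] have "open T" by (simp add: T_def Int_ac)
  show ?thesis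
  proof (rule analytic_continuation_open[of T S \<phi> \<psi>])
    show "T \<noteq> {}" using u V by (auto simp: T_def)
    show "\<phi> z = \<psi> z" if "z \<in> T" for z
    proof -
      have "\<phi> z = g (F (\<phi> z))" "\<psi> z = g (F (\<psi> z))" using V(3) that by (auto simp: T_def)
      then show ?thesis using \<phi> \<psi> that by (simp add: sect_def T_def)
    qed
  qed (use \<open>open T\<close> S \<phi> \<psi> v in \<open>auto simp: sect_def T_def\<close>)
qed

lemma sect_glue:
  assumes op: "\<And>i. i \<in> I \<Longrightarrow> open (S i)" and sec: "\<And>i. i \<in> I \<Longrightarrow> sect (S i) (\<phi> i)"
    and agree: "\<And>i j u. i \<in> I \<Longrightarrow> j \<in> I \<Longrightarrow> u \<in> S i \<Longrightarrow> u \<in> S j \<Longrightarrow> \<phi> i u = \<phi> j u"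
  obtains \<Phi> where "sect (\<Union>i\<in>I. S i) \<Phi>" "\<And>i u. i \<in> I \<Longrightarrow> u \<in> S i \<Longrightarrow> \<Phi> u = \<phi> i u"
proof -
  define \<Phi> where "\<Phi> u = \<phi> (SOME i. i \<in> I \<and> u \<in> S i) u" for u
  have eq: "\<Phi> u = \<phi> i u" if "i \<in> I" "u \<in> S i" for i u
  proof -
    have "(SOME i. i \<in> I \<and> u \<in> S i) \<in> I \<and> u \<in> S (SOME i. i \<in> I \<and> u \<in> S i)"
      by (rule someI[of _ i]) (use that in auto)
    then show ?thesis unfolding \<Phi>_def using agree that by blast
  qed
  have "\<Phi> holomorphic_on (\<Union>i\<in>I. S i)"
  proof (rule holomorphic_on_UN_open)
    fix i assume i: "i \<in> I"
    show "\<Phi> holomorphic_on S i"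
      by (rule holomorphic_transform[of "\<phi> i"]) (use sec[OF i] eq[OF i] in \<open>auto simp: sect_def\<close>)
  qed (rule op)
  then have "sect (\<Union>i\<in>I. S i) \<Phi>" using sec eq by (auto simp: sect_def)
  then show ?thesis using that eq by blast
qed

section \<open>Continuation of sections to maximal discs\<close>

text \<open>This leaves escape to infinity as the only obstruction to continuing a section. At a
  limit that is not a pole the identity \<open>f z * F z = 1\<close> survives, so \<open>u1\<close>
  is nonzero and its bound keeps \<open>f z1\<close> large.\<close>

lemma limit_in_\<Omega>:
  assumes z: "\<And>n. z n \<in> \<Omega>" "z \<longlonglongrightarrow> z1" and F: "(\<lambda>n. F (z n)) \<longlonglongrightarrow> u1" and u1: "norm u1 < r0"
  shows "z1 \<in> \<Omega>" "F z1 = u1"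
proof -
  have "z1 \<in> \<Omega> \<and> F z1 = u1"
  proof (cases "is_pole f z1")
    case True
    then have z1: "z1 \<in> \<Omega>" by (simp add: \<Omega>_def)
    then have "(\<lambda>n. F (z n)) \<longlonglongrightarrow> F z1" using isCont_F isCont_tendsto_compose z(2) by blast
    then show ?thesis using z1 F LIMSEQ_unique by blast
  next
    case False
    have "isCont f z1" using analytic_at_imp_isCont analytic_at_nonpole[OF False] by blast
    then have "(\<lambda>n. f (z n)) \<longlonglongrightarrow> f z1" using isCont_tendsto_compose z(2) by blast
    then have "(\<lambda>n. f (z n) * F (z n)) \<longlonglongrightarrow> f z1 * u1" using F by (rule tendsto_mult)
    moreover have "eventually (\<lambda>n. f (z n) * F (z n) = 1) sequentially"
    proof -
      have "eventually (\<lambda>n. z n \<in> {z. \<not> is_pole f z}) sequentially"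
        using topological_tendstoD[OF z(2) open_nonpoles] False by auto
      then show ?thesis
      proof eventually_elim
        case (elim n)
        then have "F (z n) \<noteq> 0" using z(1)[of n] F_eq_0_iff by auto
        then show ?case by (simp add: F_def)
      qed
    qed
    ultimately have "f z1 * u1 = 1"
      using tendsto_eventually LIMSEQ_unique by metis
    then have u0: "u1 \<noteq> 0" and fz: "f z1 = 1 / u1" by (auto intro: eq_divide_imp)
    then have "norm (f z1) > 1 / r0" using u1 r0 by (simp add: norm_divide frac_less2)
    then show ?thesis using fz by (simp add: \<Omega>_def F_def)
  qed
  then show "z1 \<in> \<Omega>" "F z1 = u1" by auto
qed

text \<open>Inversion carries the limit of \<open>F\<close> to the sphere, with
  \<open>u1 = 0\<close> going to infinity. Staying in \<open>\<Omega>\<close> ensures that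
  \<open>F\<close> vanishes along the curve only at genuine poles.\<close>

lemma asymptotic_valueI:
  fixes \<gamma> :: "real \<Rightarrow> complex"
  assumes "continuous_on {0..} \<gamma>" "filterlim \<gamma> at_infinity at_top"
    and \<Omega>: "\<And>t. t \<ge> 0 \<Longrightarrow> \<gamma> t \<in> \<Omega>" and lim: "((\<lambda>t. F (\<gamma> t)) \<longlongrightarrow> u1) at_top"
  shows "asymptotic_value f (if u1 = 0 then None else Some (inverse u1))"
  unfolding asymptotic_value_def
proof (intro exI[of _ \<gamma>] conjI assms)
  have ev0: "eventually (\<lambda>t::real. t \<ge> 0) at_top" by (rule eventually_ge_at_top)
  show "limitin riemann_sphere (\<lambda>t. to_sphere f (\<gamma> t)) (if u1 = 0 then None else Some (inverse u1)) at_top"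
    unfolding limitin_def
  proof (intro conjI allI impI)
    show "(if u1 = 0 then None else Some (inverse u1)) \<in> topspace riemann_sphere"
      by auto
    fix U assume "openin riemann_sphere U \<and> (if u1 = 0 then None else Some (inverse u1)) \<in> U"
    then have U: "openin riemann_sphere U" "(if u1 = 0 then None else Some (inverse u1)) \<in> U" by auto
    show "\<forall>\<^sub>F t in at_top. to_sphere f (\<gamma> t) \<in> U"
    proof (cases "u1 = 0")
      case False
      have "\<exists>W. open W \<and> inverse u1 \<in> W \<and> Some ` W \<subseteq> U"
        using U False unfolding openin_Alexandroff_compactification
        by (auto simp: closed_def)
      then obtain W where W: "open W" "inverse u1 \<in> W" "Some ` W \<subseteq> U" by blast
      have "((\<lambda>t. inverse (F (\<gamma> t))) \<longlongrightarrow> inverse u1) at_top"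
        using lim False by (intro tendsto_inverse)
      then have "eventually (\<lambda>t. inverse (F (\<gamma> t)) \<in> W) at_top"
        using topological_tendstoD W by blast
      moreover have "eventually (\<lambda>t. F (\<gamma> t) \<noteq> 0) at_top"
        using lim False tendsto_imp_eventually_ne by blast
      ultimately show ?thesis using ev0
      proof eventually_elim
        case (elim t)
        then show ?case using F_eq_0_iff[OF \<Omega>] W(3) by (auto simp: to_sphere_def F_def)
      qed
    next
      case True
      then obtain C where C: "compact C" "U = insert None (Some ` (- C))"
        using U unfolding openin_Alexandroff_compactification by (auto simp: Compl_eq_Diff_UNIV)
      obtain B where B: "B > 0" "\<And>w. w \<in> C \<Longrightarrow> norm w \<le> B"
        using compact_imp_bounded[OF C(1)] bounded_pos by metis
      have "eventually (\<lambda>t. norm (F (\<gamma> t)) < 1 / (B + 1)) at_top"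
        using lim True B(1) tendstoD[of "\<lambda>t. F (\<gamma> t)" 0 at_top "1 / (B + 1)"] by (simp add: dist_norm)
      then show ?thesis using ev0
      proof eventually_elim
        case (elim t)
        show ?case
        proof (cases "is_pole f (\<gamma> t)")
          case False
          then have "F (\<gamma> t) \<noteq> 0" using F_eq_0_iff[OF \<Omega>] elim by auto
          then have "norm (f (\<gamma> t)) > 0" by (auto simp: F_def)
          moreover have "inverse (norm (f (\<gamma> t))) < inverse (B + 1)"
            using elim(1) by (simp add: F_def norm_inverse divide_inverse)
          ultimately have "norm (f (\<gamma> t)) > B + 1" by (metis inverse_less_imp_less)
          then have "f (\<gamma> t) \<notin> C" using B(2) by fastforce
          then show ?thesis using False C(2) by (auto simp: to_sphere_def)
        qed (use C(2) in \<open>auto simp: to_sphere_def\<close>)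
      qed
    qed
  qed
qed

text \<open>The image of the radius would be an asymptotic path for \<open>inverse u1\<close>, or
  for infinity if \<open>u1 = 0\<close>, and \<open>norm u1 < r0\<close> places this value where
  nothing is singular.\<close>

lemma sect_radial_not_at_infinity:
  assumes sec: "sect (ball u0 \<rho>) \<phi>" and u1: "dist u0 u1 = \<rho>" "norm u1 < r0" and \<rho>: "\<rho> > 0"
  shows "\<not> filterlim (\<lambda>t. \<phi> (u0 + of_real t * (u1 - u0))) at_infinity (at_left 1)"
proof
  assume inf: "filterlim (\<lambda>t. \<phi> (u0 + of_real t * (u1 - u0))) at_infinity (at_left 1)"
  \<comment> \<open>A reparametrisation of the half-open radius by \<open>[0, \<infinity>)\<close>,
    as the definition of asymptotic values demands.\<close>
  define h where "h s = 1 - exp (- s)" for s :: real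
  define \<gamma> where "\<gamma> s = \<phi> (u0 + of_real (h s) * (u1 - u0))" for s
  have hlim: "filterlim h (at_left 1) at_top" unfolding h_def by real_asymp
  have hb: "u0 + of_real (h s) * (u1 - u0) \<in> ball u0 \<rho>" if "s \<ge> 0" for s
  proof -
    have "0 \<le> h s" "h s < 1" using that by (auto simp: h_def)
    then show ?thesis using u1(1) \<rho> by (simp add: dist_norm norm_mult norm_minus_commute)
  qed
  have "continuous_on {0..} \<gamma>"
    unfolding \<gamma>_def
  proof (rule continuous_on_compose2[of "ball u0 \<rho>" \<phi>])
    show "continuous_on (ball u0 \<rho>) \<phi>" using sec holomorphic_on_imp_continuous_on by (auto simp: sect_def)
    show "continuous_on {0..} (\<lambda>s. u0 + of_real (h s) * (u1 - u0))"
      unfolding h_def by (intro continuous_intros)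
  qed (use hb in auto)
  moreover have "filterlim \<gamma> at_infinity at_top"
    unfolding \<gamma>_def by (rule filterlim_compose[OF inf hlim])
  moreover have "\<gamma> t \<in> \<Omega>" if "t \<ge> 0" for t
    using sec hb[OF that] by (simp add: sect_def \<gamma>_def)
  moreover have "((\<lambda>t. F (\<gamma> t)) \<longlongrightarrow> u1) at_top"
  proof (rule Lim_transform_eventually)
    have "(h \<longlongrightarrow> 1) at_top" using hlim by (simp add: filterlim_at)
    then have "((\<lambda>s. u0 + of_real (h s) * (u1 - u0)) \<longlongrightarrow> u0 + of_real 1 * (u1 - u0)) at_top"
      by (intro tendsto_intros)
    then show "((\<lambda>s. u0 + of_real (h s) * (u1 - u0)) \<longlongrightarrow> u1) at_top" by simp
    show "\<forall>\<^sub>F s in at_top. u0 + of_real (h s) * (u1 - u0) = F (\<gamma> s)"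
      using eventually_ge_at_top[of 0]
      by eventually_elim (use sec hb in \<open>auto simp: sect_def \<gamma>_def\<close>)
  qed
  ultimately have "asymptotic_value f (if u1 = 0 then None else Some (inverse u1))"
    by (rule asymptotic_valueI)
  then have "singular_value f (if u1 = 0 then None else Some (inverse u1))"
    by (simp add: singular_value_def)
  moreover have "norm (inverse u1) > 1 / r0" if "u1 \<noteq> 0"
    using that u1(2) by (simp add: norm_inverse divide_inverse less_imp_inverse_less)
  ultimately show False using no_sing no_sing_inf by (auto split: if_splits)
qed

text \<open>Since \<open>\<phi>\<close> does not tend to infinity along the radius, it has a finite
  limit point \<open>z1\<close> over \<open>u1\<close>. The local section through \<open>z1\<close>
  meets \<open>\<phi>\<close> at some point and hence agrees with it on the overlap of the two
  discs, which is convex.\<close>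

lemma sect_boundary:
  assumes sec: "sect (ball u0 \<rho>) \<phi>" and u1: "dist u0 u1 = \<rho>" "norm u1 < r0" and \<rho>: "\<rho> > 0"
  shows "\<exists>e \<psi>. e > 0 \<and> sect (ball u1 e) \<psi> \<and> (\<forall>u\<in>ball u0 \<rho> \<inter> ball u1 e. \<psi> u = \<phi> u)"
proof -
  define l where "l t = u0 + of_real t * (u1 - u0)" for t :: real
  \<comment> \<open>Failure of divergence only yields boundedness frequently, not eventually; hence
    a sequence of radii is chosen first and a convergent subsequence afterwards.\<close>
  have "\<exists>B. \<not> eventually (\<lambda>t. norm (\<phi> (l t)) > B) (at_left 1)"
    using sect_radial_not_at_infinity[OF assms] unfolding filterlim_at_infinity[OF order_refl]
    by (auto simp: l_def elim!: eventually_mono)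
      (metis (mono_tags, lifting) eventually_mono less_imp_le)
  then obtain B where B: "\<exists>\<^sub>F t in at_left 1. \<not> norm (\<phi> (l t)) > B" by (auto simp: frequently_def)
  have "\<exists>t. 1 - inverse (real (Suc n)) < t \<and> 0 < t \<and> t < 1 \<and> norm (\<phi> (l t)) \<le> B" for n
  proof -
    have "eventually (\<lambda>t. t \<in> {max 0 (1 - inverse (real (Suc n)))<..<1}) (at_left 1)"
      by (rule eventually_at_leftI[of "max 0 (1 - inverse (real (Suc n)))"]) auto
    from frequently_eventually_frequently[OF B this] show ?thesis
      by (auto dest!: frequently_ex)
  qed
  then obtain t where t: "\<And>n. 1 - inverse (real (Suc n)) < t n" "\<And>n. 0 < t n" "\<And>n. t n < 1"
     "\<And>n. norm (\<phi> (l (t n))) \<le> B" by metis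
  have t1: "t \<longlonglongrightarrow> 1"
  proof (rule tendsto_sandwich)
    show "(\<lambda>n. 1 - inverse (real (Suc n))) \<longlonglongrightarrow> 1"
      using LIMSEQ_inverse_real_of_nat_add_minus[of 1] by simp
  qed (use t in \<open>auto intro!: always_eventually less_imp_le\<close>)
  have lb: "l (t n) \<in> ball u0 \<rho>" for n
    using t(2,3)[of n] u1(1) \<rho> by (simp add: l_def dist_norm norm_mult norm_minus_commute)
  obtain z1 \<sigma> where z1: "strict_mono (\<sigma> :: nat \<Rightarrow> nat)" "((\<lambda>n. \<phi> (l (t n))) \<circ> \<sigma>) \<longlonglongrightarrow> z1"
  proof -
    have "compact (cball (0::complex) B)" by simp
    moreover have "\<phi> (l (t n)) \<in> cball 0 B" for n using t(4) by simp
    ultimately show ?thesis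
      using that unfolding compact_def by (metis (no_types, lifting))
  qed
  have t\<sigma>: "(t \<circ> \<sigma>) \<longlonglongrightarrow> 1" by (rule LIMSEQ_subseq_LIMSEQ[OF t1 z1(1)])
  have "(\<lambda>n. l ((t \<circ> \<sigma>) n)) \<longlonglongrightarrow> u0 + of_real 1 * (u1 - u0)"
    unfolding l_def by (intro tendsto_intros t\<sigma>)
  then have l1: "(\<lambda>n. F (\<phi> (l (t (\<sigma> n))))) \<longlonglongrightarrow> u1"
    using sec lb by (simp add: sect_def)
  have z1': "z1 \<in> \<Omega>" "F z1 = u1"
    using limit_in_\<Omega>[of "(\<lambda>n. \<phi> (l (t n))) \<circ> \<sigma>" z1 u1] z1(2) l1 u1(2) sec lb by (auto simp: sect_def)
  obtain e \<psi> V where e: "e > 0" "sect (ball u1 e) \<psi>" "open V" "z1 \<in> V"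
    "\<And>x. x \<in> V \<Longrightarrow> F x \<in> ball u1 e \<and> \<psi> (F x) = x"
    using local_sect[OF z1'(1)] unfolding z1'(2) by metis
  obtain n where n: "\<phi> (l (t (\<sigma> n))) \<in> V"
    using topological_tendstoD[OF z1(2) e(3,4)] by (auto simp: eventually_sequentially)
  define u where "u = l (t (\<sigma> n))"
  have u: "F (\<phi> u) = u" "u \<in> ball u0 \<rho>" using sec lb by (auto simp: sect_def u_def)
  have "\<psi> v = \<phi> v" if v: "v \<in> ball u0 \<rho> \<inter> ball u1 e" for v
  proof (rule sect_unique[of "ball u0 \<rho> \<inter> ball u1 e" \<psi> \<phi> u v])
    show "connected (ball u0 \<rho> \<inter> ball u1 e)" by (intro convex_connected convex_Int convex_ball)
    show "u \<in> ball u0 \<rho> \<inter> ball u1 e" "\<psi> u = \<phi> u" using e(5)[OF n] u by (auto simp: u_def)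
  qed (use v sec e(2) in \<open>auto intro: sect_subset\<close>)
  then show ?thesis using e by blast
qed

text \<open>The extensions at the points of the boundary circle agree on overlaps, so they glue with
  \<open>\<phi>\<close> to a section on a neighbourhood of the closed disc. By compactness this
  neighbourhood contains a larger disc.\<close>

lemma sect_extend:
  assumes sec: "sect (ball u0 \<rho>) \<phi>" and sub: "cball u0 \<rho> \<subseteq> ball 0 r0" and \<rho>: "\<rho> > 0"
  obtains \<rho>' \<Phi> where "\<rho>' > \<rho>" "sect (ball u0 \<rho>') \<Phi>" "\<Phi> u0 = \<phi> u0"
proof -
  have "\<forall>u1\<in>sphere u0 \<rho>. \<exists>e \<psi>. e > 0 \<and> sect (ball u1 e) \<psi> \<and> (\<forall>u\<in>ball u0 \<rho> \<inter> ball u1 e. \<psi> u = \<phi> u)"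
  proof
    fix u1 assume "u1 \<in> sphere u0 \<rho>"
    then show "\<exists>e \<psi>. e > 0 \<and> sect (ball u1 e) \<psi> \<and> (\<forall>u\<in>ball u0 \<rho> \<inter> ball u1 e. \<psi> u = \<phi> u)"
      using sub by (intro sect_boundary[OF sec _ _ \<rho>]) auto
  qed
  then obtain e \<psi> where e: "\<And>x. x \<in> sphere u0 \<rho> \<Longrightarrow> e x > 0" "\<And>x. x \<in> sphere u0 \<rho> \<Longrightarrow> sect (ball x (e x)) (\<psi> x)"
      "\<And>x u. x \<in> sphere u0 \<rho> \<Longrightarrow> u \<in> ball u0 \<rho> \<Longrightarrow> u \<in> ball x (e x) \<Longrightarrow> \<psi> x u = \<phi> u"
    by (metis Int_iff)
  \<comment> \<open>The centre, which is not on the circle, serves as the index of the original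
    disc, so that one family contains all pieces.\<close>
  define S where "S = (\<lambda>x. if x = u0 then ball u0 \<rho> else ball x (e x))"
  define G where "G = (\<lambda>x. if x = u0 then \<phi> else \<psi> x)"
  define I where "I = insert u0 (sphere u0 \<rho>)"
  have u0: "u0 \<notin> sphere u0 \<rho>" using \<rho> by simp
  have agree: "\<psi> x u = \<psi> y u" if xy: "x \<in> sphere u0 \<rho>" "y \<in> sphere u0 \<rho>" "u \<in> ball x (e x)" "u \<in> ball y (e y)" for x y u
  proof (cases "x = y")
    case False
    define s where "s = e x / (e x + e y)"
    note ep = e(1)[OF xy(1)] e(1)[OF xy(2)]
    have s: "0 < s" "s < 1" using ep by (auto simp: s_def field_simps)
    define p where "p = (1 - s) *\<^sub>R x + s *\<^sub>R y"
    have d: "dist x y < e x + e y" using xy(3,4) dist_triangle[of x y u] by (simp add: dist_commute)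
    \<comment> \<open>two overlapping discs centred on the circle also overlap inside it, where both sections are \<open>\<phi>\<close>\<close>
    have "p \<in> open_segment x y" unfolding in_segment p_def using s False by blast
    then have "dist u0 p < \<rho>" using dist_decreases_open_segment[of p x y u0] xy(1,2) by auto
    moreover have "dist x p < e x"
    proof -
      have "x - p = s *\<^sub>R (x - y)" by (simp add: p_def algebra_simps)
      then have "dist x p = s * dist x y" using s by (simp add: dist_norm)
      also have "\<dots> < s * (e x + e y)" using d s by simp
      also have "\<dots> = e x" using ep by (simp add: s_def)
      finally show ?thesis .
    qed
    moreover have "dist y p < e y"
    proof -
      have "y - p = (1 - s) *\<^sub>R (y - x)" by (simp add: p_def algebra_simps)
      then have "dist y p = (1 - s) * dist x y" using s by (simp add: dist_norm norm_minus_commute)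
      also have "\<dots> < (1 - s) * (e x + e y)" using d s by simp
      also have "\<dots> = e y" using ep by (simp add: s_def field_simps)
      finally show ?thesis .
    qed
    ultimately have p: "p \<in> ball u0 \<rho>" "p \<in> ball x (e x)" "p \<in> ball y (e y)" by auto
    show ?thesis
    proof (rule sect_unique[of "ball x (e x) \<inter> ball y (e y)" "\<psi> x" "\<psi> y" p u])
      show "connected (ball x (e x) \<inter> ball y (e y))" by (intro convex_connected convex_Int convex_ball)
      show "sect (ball x (e x) \<inter> ball y (e y)) (\<psi> x)" "sect (ball x (e x) \<inter> ball y (e y)) (\<psi> y)"
        using e(2) xy(1,2) by (blast intro: sect_subset)+
      show "\<psi> x p = \<psi> y p" using e(3) xy(1,2) p by metis
    qed (use p xy in auto)
  qed auto
  have "sect (S i) (G i)" if "i \<in> I" for i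
    using that e(2) sec u0 by (auto simp: S_def G_def I_def)
  moreover have "G i u = G j u" if "i \<in> I" "j \<in> I" "u \<in> S i" "u \<in> S j" for i j u
  proof -
    have "i = u0 \<or> i \<noteq> u0 \<and> i \<in> sphere u0 \<rho>" "j = u0 \<or> j \<noteq> u0 \<and> j \<in> sphere u0 \<rho>"
      using that u0 by (auto simp: I_def)
    then show ?thesis using that(3,4) e(3)[of i u] e(3)[of j u] agree[of i j u]
      by (elim disjE) (simp_all add: S_def G_def)
  qed
  moreover have "open (S i)" for i by (simp add: S_def)
  ultimately obtain \<Phi> where \<Phi>: "sect (\<Union>i\<in>I. S i) \<Phi>" "\<And>i u. i \<in> I \<Longrightarrow> u \<in> S i \<Longrightarrow> \<Phi> u = G i u"
    using sect_glue[of I S G] by metis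
  have cov: "cball u0 \<rho> \<subseteq> (\<Union>i\<in>I. S i)"
  proof
    fix x assume x: "x \<in> cball u0 \<rho>"
    show "x \<in> (\<Union>i\<in>I. S i)"
    proof (cases "x \<in> sphere u0 \<rho>")
      case True then show ?thesis using e(1)[OF True] u0 by (intro UN_I[of x]) (auto simp: I_def S_def)
    next
      case False then show ?thesis using x by (intro UN_I[of u0]) (auto simp: I_def S_def)
    qed
  qed
  have "open (\<Union>i\<in>I. S i)" by (auto simp: S_def)
  from compact_subset_open_imp_ball_epsilon_subset[OF compact_cball this cov]
  obtain d where d: "d > 0" "(\<Union>x\<in>cball u0 \<rho>. ball x d) \<subseteq> (\<Union>i\<in>I. S i)" by blast
  have "ball u0 (\<rho> + d) \<subseteq> (\<Union>x\<in>cball u0 \<rho>. ball x d)"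
  proof
    fix u assume u: "u \<in> ball u0 (\<rho> + d)"
    show "u \<in> (\<Union>x\<in>cball u0 \<rho>. ball x d)"
    proof (cases "u \<in> cball u0 \<rho>")
      case False
      \<comment> \<open>\<open>c\<close> projects \<open>u\<close> radially to the circle, at
        distance \<open>dist u0 u - \<rho>\<close> from \<open>u\<close>.\<close>
      define c where "c = \<rho> / dist u0 u"
      have du: "dist u0 u > \<rho>" "dist u0 u < \<rho> + d" using False u by auto
      have "dist u0 u > 0" using du(1) \<rho> by linarith
      then have c: "0 < c" "c < 1" using du \<rho> unfolding c_def by (simp_all del: zero_less_dist_iff)
      define x where "x = u0 + c *\<^sub>R (u - u0)"
      have "dist u0 x = c * dist u0 u" using c by (simp add: x_def dist_norm norm_minus_commute)
      also have "\<dots> = \<rho>" using \<open>dist u0 u > 0\<close> unfolding c_def by (simp del: zero_less_dist_iff)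
      finally have "x \<in> cball u0 \<rho>" by simp
      moreover have "x - u = (1 - c) *\<^sub>R (u0 - u)" by (simp add: x_def algebra_simps)
      then have "dist x u = (1 - c) * dist u0 u" using c by (simp add: dist_norm)
      then have "dist x u = dist u0 u - \<rho>" using \<open>dist u0 u > 0\<close> by (simp add: c_def field_simps)
      then have "u \<in> ball x d" using du by simp
      ultimately show ?thesis by blast
    next
      case True then show ?thesis using d(1) by (intro UN_I[of u]) auto
    qed
  qed
  then have "sect (ball u0 (\<rho> + d)) \<Phi>" using d(2) sect_subset[OF \<Phi>(1)] by blast
  moreover have "\<Phi> u0 = \<phi> u0" using \<Phi>(2)[of u0 u0] \<rho> by (simp add: I_def S_def G_def)
  ultimately show ?thesis using that[of "\<rho> + d" \<Phi>] d(1) by simp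
qed

text \<open>The disc is the largest one about \<open>F z\<close> inside \<open>ball 0 r0\<close>. By
  uniqueness the sections on smaller discs combine on the supremum of their radii, and
  \<open>sect_extend\<close> shows that the supremum cannot stop early.\<close>

lemma sect_maximal:
  assumes z: "z \<in> \<Omega>"
  shows "\<exists>\<phi>. sect (ball (F z) (r0 - norm (F z))) \<phi> \<and> \<phi> (F z) = z"
proof -
  define u0 R where "u0 = F z" and "R = r0 - norm u0"
  have R: "R > 0" using norm_F_less[OF z] by (simp add: R_def u0_def)
  define A where "A = {\<rho>. 0 < \<rho> \<and> \<rho> \<le> R \<and> (\<exists>\<phi>. sect (ball u0 \<rho>) \<phi> \<and> \<phi> u0 = z)}"
  obtain e \<psi> where e: "e > 0" "sect (ball u0 e) \<psi>" "\<psi> u0 = z"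
    using local_sect[OF z] unfolding u0_def by metis
  have "sect (ball u0 (min e R)) \<psi>" by (rule sect_subset[OF e(2)]) (simp add: subset_ball)
  then have eA: "min e R \<in> A" using e R by (auto simp: A_def)
  have bdd: "bdd_above A" by (auto simp: A_def bdd_above_def)
  obtain \<phi> where \<phi>: "\<And>\<rho>. \<rho> \<in> A \<Longrightarrow> sect (ball u0 \<rho>) (\<phi> \<rho>) \<and> \<phi> \<rho> u0 = z"
  proof -
    have "\<forall>\<rho>\<in>A. \<exists>\<phi>. sect (ball u0 \<rho>) \<phi> \<and> \<phi> u0 = z" by (auto simp: A_def)
    then show ?thesis using that by metis
  qed
  have ag: "\<phi> a u = \<phi> b u" if "a \<in> A" "b \<in> A" "u \<in> ball u0 a" "u \<in> ball u0 b" for a b u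
  proof (rule sect_unique[of "ball u0 a \<inter> ball u0 b" "\<phi> a" "\<phi> b" u0 u])
    show "connected (ball u0 a \<inter> ball u0 b)" by (intro convex_connected convex_Int convex_ball)
    show "sect (ball u0 a \<inter> ball u0 b) (\<phi> a)" "sect (ball u0 a \<inter> ball u0 b) (\<phi> b)"
      using \<phi> that by (blast intro: sect_subset)+
  qed (use that \<phi> in \<open>auto simp: A_def\<close>)
  obtain \<Phi> where \<Phi>: "sect (\<Union>\<rho>\<in>A. ball u0 \<rho>) \<Phi>" "\<And>\<rho> u. \<rho> \<in> A \<Longrightarrow> u \<in> ball u0 \<rho> \<Longrightarrow> \<Phi> u = \<phi> \<rho> u"
    using sect_glue[of A "ball u0" \<phi>] \<phi> ag by (metis open_ball)
  define S where "S = Sup A"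
  have S: "min e R \<le> S" unfolding S_def by (rule cSup_upper[OF eA bdd])
  then have S0: "S > 0" using e R by auto
  have SR: "S \<le> R" unfolding S_def
  proof (rule cSup_least)
    show "A \<noteq> {}" using eA by blast
  qed (simp add: A_def)
  have "ball u0 S \<subseteq> (\<Union>\<rho>\<in>A. ball u0 \<rho>)"
  proof
    fix u assume "u \<in> ball u0 S"
    then obtain \<rho> where "\<rho> \<in> A" "dist u0 u < \<rho>"
      using less_cSup_iff[of A "dist u0 u"] eA bdd unfolding S_def by auto
    then show "u \<in> (\<Union>\<rho>\<in>A. ball u0 \<rho>)" by auto
  qed
  then have sS: "sect (ball u0 S) \<Phi>" by (rule sect_subset[OF \<Phi>(1)])
  have \<Phi>0: "\<Phi> u0 = z" using \<Phi>(2)[OF eA, of u0] \<phi>[OF eA] e R by auto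
  have "S = R"
  proof (rule ccontr)
    assume "S \<noteq> R"
    then have "S < R" using SR by simp
    have "cball u0 S \<subseteq> ball 0 r0"
    proof
      fix u assume "u \<in> cball u0 S"
      then have "norm u \<le> norm u0 + S" using norm_triangle_sub[of u u0] by (simp add: dist_norm norm_minus_commute)
      then show "u \<in> ball 0 r0" using \<open>S < R\<close> by (simp add: R_def)
    qed
    from sect_extend[OF sS this S0] obtain S' \<Psi> where S': "S' > S" "sect (ball u0 S') \<Psi>" "\<Psi> u0 = \<Phi> u0" by blast
    have "sect (ball u0 (min S' R)) \<Psi>" by (rule sect_subset[OF S'(2)]) (simp add: subset_ball)
    then have "min S' R \<in> A" using S' R S0 \<Phi>0 by (auto simp: A_def)
    then have "min S' R \<le> S" unfolding S_def by (rule cSup_upper[OF _ bdd])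
    then show False using S' \<open>S < R\<close> by auto
  qed
  then show ?thesis using sS \<Phi>0 unfolding u0_def R_def by blast
qed

section \<open>The branches at the poles\<close>

definition branch :: "complex \<Rightarrow> complex \<Rightarrow> complex" where
  "branch p = (SOME \<phi>. sect (ball 0 r0) \<phi> \<and> \<phi> 0 = p)"

lemma branch:
  assumes "is_pole f p"
  shows "sect (ball 0 r0) (branch p)" "branch p 0 = p"
proof -
  have "\<exists>\<phi>. sect (ball 0 r0) \<phi> \<and> \<phi> 0 = p"
    using sect_maximal[of p] F_pole[OF assms] assms by (simp add: \<Omega>_def)
  from someI_ex[OF this] show "sect (ball 0 r0) (branch p)" "branch p 0 = p"
    by (auto simp: branch_def)
qed

lemma inj_on_branch: "is_pole f p \<Longrightarrow> inj_on (branch p) (ball 0 r0)"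
  using branch(1)[of p] unfolding sect_def by (metis inj_on_inverseI)

lemma F_branch: "is_pole f p \<Longrightarrow> norm u < r0 \<Longrightarrow> F (branch p u) = u"
  using branch(1)[of p] by (simp add: sect_def)

lemma branch_nonpole:
  assumes "is_pole f p" "norm u < r0" "u \<noteq> 0"
  shows "\<not> is_pole f (branch p u)" "f (branch p u) = inverse u"
  using F_branch[OF assms(1,2)] assms(3) F_pole[of "branch p u"] unfolding F_def
  by (auto simp: inverse_eq_imp_eq)

text \<open>Applying \<open>F\<close> shows that the two parameters agree; sections that meet once
  also agree at the centre, where their values are the poles.\<close>

lemma branch_disjoint:
  assumes p: "is_pole f p" and q: "is_pole f q" and u: "norm u < r0" "norm v < r0"
    and eq: "branch p u = branch q v"
  shows "p = q"
proof -
  have "u = v" using F_branch[OF p u(1)] F_branch[OF q u(2)] eq by simp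
  have "branch p 0 = branch q 0"
  proof (rule sect_unique[OF open_ball _ branch(1)[OF p] branch(1)[OF q], of u])
    show "branch p u = branch q u" using eq \<open>u = v\<close> by simp
  qed (use u r0 in simp_all)
  then show ?thesis using branch(2) p q by simp
qed

text \<open>The factor \<open>2\<close> gives \<open>norm (F z) < r0 / 2\<close>, so the maximal
  disc about \<open>F z\<close> contains \<open>0\<close>. The section through \<open>z\<close>
  therefore reaches a pole and is a restriction of the branch at that pole.\<close>

lemma branch_cover:
  assumes z: "\<not> is_pole f z" "norm (f z) > 2 / r0"
  obtains p where "is_pole f p" "z = branch p (inverse (f z))" "norm (inverse (f z)) < r0"
proof -
  have "1 / r0 < 2 / r0" using r0 by (simp add: divide_strict_right_mono)
  then have z\<Omega>: "z \<in> \<Omega>" using z(2) unfolding \<Omega>_def by (auto intro: less_trans)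
  obtain \<psi> where \<psi>: "sect (ball (F z) (r0 - norm (F z))) \<psi>" "\<psi> (F z) = z"
    using sect_maximal[OF z\<Omega>] by blast
  have "0 < 2 / r0" using r0 by simp
  then have fp: "norm (f z) > 0" using z(2) by (rule less_trans)
  have "norm (F z) < r0 / 2"
    using less_imp_inverse_less[OF z(2)] r0 by (simp add: F_def norm_inverse)
  then have in_ball: "0 \<in> ball (F z) (r0 - norm (F z))" "F z \<in> ball (F z) (r0 - norm (F z))"
    using norm_F_less[OF z\<Omega>] by (auto simp: dist_norm)
  have F0: "F (\<psi> 0) = 0" "\<psi> 0 \<in> \<Omega>" using \<psi>(1) in_ball(1) by (auto simp: sect_def)
  then have p: "is_pole f (\<psi> 0)" using F_eq_0_iff by blast
  have sub: "ball (F z) (r0 - norm (F z)) \<subseteq> ball 0 r0"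
    by (simp add: ball_subset_ball_iff)
  have "\<psi> (F z) = branch (\<psi> 0) (F z)"
  proof (rule sect_unique[OF open_ball _ \<psi>(1) _ in_ball(1) _ in_ball(2)])
    show "sect (ball (F z) (r0 - norm (F z))) (branch (\<psi> 0))"
      by (rule sect_subset[OF branch(1)[OF p] sub])
  qed (use branch(2)[OF p] in auto)
  then show ?thesis
    using that[OF p] \<psi>(2) norm_F_less[OF z\<Omega>] by (simp add: F_def)
qed

text \<open>Both sides equal the reciprocal of \<open>deriv F p\<close>: one by the chain rule for
  \<open>F (branch p u) = u\<close>, the other by the residue formula at a simple pole.\<close>

lemma deriv_branch:
  assumes p: "is_pole f p"
  shows "deriv (branch p) 0 = residue f p"
proof -
  have p\<Omega>: "p \<in> \<Omega>" using p by (simp add: \<Omega>_def)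
  obtain S where S: "open S" "p \<in> S" "S \<subseteq> \<Omega>" "F holomorphic_on S" "\<forall>w\<in>S - {p}. \<not> is_pole f w"
    using local_\<Omega>[OF p\<Omega>] by blast
  have dF: "(F has_field_derivative deriv F p) (at p)"
    by (rule holomorphic_derivI[OF S(4,1,2)])
  have d\<phi>: "(branch p has_field_derivative deriv (branch p) 0) (at 0)"
    by (rule holomorphic_derivI[OF _ open_ball, of _ 0 r0]) (use branch(1)[OF p] r0 in \<open>auto simp: sect_def\<close>)
  have "((\<lambda>u. F (branch p u)) has_field_derivative deriv F p * deriv (branch p) 0) (at 0)"
    using DERIV_chain2[of F "deriv F p" "branch p" 0] dF d\<phi> branch(2)[OF p] by simp
  moreover have "((\<lambda>u. F (branch p u)) has_field_derivative 1) (at 0)"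
  proof (rule has_field_derivative_transform_within_open[of "\<lambda>u. u" 1 0 "ball 0 r0"])
    show "u = F (branch p u)" if "u \<in> ball 0 r0" for u using F_branch[OF p] that by simp
  qed (use r0 in auto)
  ultimately have prod: "deriv F p * deriv (branch p) 0 = 1" by (rule DERIV_unique)
  have "residue f p = inverse (deriv F p)"
  proof (rule residue_simple'[OF S(1,2)])
    show "f holomorphic_on S - {p}"
      by (rule holomorphic_on_subset[OF holomorphic_nonpoles]) (use S in auto)
    have "((\<lambda>w. (F w - F p) / (w - p)) \<longlongrightarrow> deriv F p) (at p)"
      using dF by (simp add: has_field_derivative_iff)
    then have "((\<lambda>w. inverse ((F w - F p) / (w - p))) \<longlongrightarrow> inverse (deriv F p)) (at p)"
      by (intro tendsto_inverse) (use prod in auto)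
    then show "((\<lambda>w. f w * (w - p)) \<longlongrightarrow> inverse (deriv F p)) (at p)"
      by (simp add: F_pole[OF p]) (simp add: F_def field_simps)
  qed
  then show ?thesis using prod by (metis inverse_unique)
qed

end

section \<open>Upper bound\<close>

locale pole_data = no_large_singular_values +
  fixes a b :: "nat \<Rightarrow> complex" and r1 B :: real
  assumes poles: "bij_betw a UNIV {z. is_pole f z}"
    and r1: "0 < r1" "2 * r1 < r0"
    and bilip: "\<And>j u v. norm u \<le> r1 \<Longrightarrow> norm v \<le> r1 \<Longrightarrow>
        norm (b j) / 2 * dist u v \<le> dist (branch (a j) u) (branch (a j) v) \<and>
        dist (branch (a j) u) (branch (a j) v) \<le> 2 * norm (b j) * dist u v"
    and b0: "\<And>j. b j \<noteq> 0" and bB: "\<And>j. norm (b j) \<le> B"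
    and a_lim: "filterlim (\<lambda>j. norm (a j)) at_top sequentially"
begin

text \<open>These disjoint compact pieces share out the poles and the points where
  \<open>norm (f z) \<ge> 1 / r1\<close>; the diameter of \<open>D j\<close> is comparable to
  \<open>r1 * norm (b j)\<close>.\<close>

definition D :: "nat \<Rightarrow> complex set" where "D j = branch (a j) ` cball 0 r1"

lemma pole_a: "is_pole f (a j)"
  using bij_betwE[OF poles] by auto

lemma inj_a: "a j = a k \<Longrightarrow> j = k"
  using bij_betw_imp_inj_on[OF poles] by (auto dest: injD)

lemma B0: "B > 0"
  using b0[of 0] bB[of 0] by (metis norm_le_zero_iff not_le order_trans)

lemma D_dist: "x \<in> D j \<Longrightarrow> dist x (a j) \<le> 2 * B * r1"
proof -
  assume "x \<in> D j"
  then obtain u where u: "norm u \<le> r1" "x = branch (a j) u" by (auto simp: D_def)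
  have "dist x (a j) \<le> 2 * norm (b j) * norm u"
    using bilip[of u 0 j] u r1 branch(2)[OF pole_a, of j] by simp
  also have "\<dots> \<le> 2 * B * r1"
    using u(1) bB[of j] B0 by (intro mult_mono) auto
  finally show ?thesis .
qed

lemma D_norm:
  assumes "x \<in> D j"
  shows "norm (a j) - 2 * B * r1 \<le> norm x" "norm x \<le> norm (a j) + 2 * B * r1"
  using D_dist[OF assms] norm_triangle_ineq2[of x "a j"] norm_triangle_ineq2[of "a j" x]
  by (auto simp: dist_norm norm_minus_commute)

lemma D_disjoint:
  assumes "x \<in> D j" "x \<in> D k" shows "j = k"
proof -
  obtain u v where "norm u \<le> r1" "x = branch (a j) u" "norm v \<le> r1" "x = branch (a k) v"
    using assms by (auto simp: D_def)
  then have "a j = a k"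
    using r1 by (intro branch_disjoint[OF pole_a pole_a, of u v]) auto
  then show ?thesis by (rule inj_a)
qed

lemma continuous_on_branch: "continuous_on (cball 0 r1) (branch (a j))"
proof -
  have "cball 0 r1 \<subseteq> (ball 0 r0 :: complex set)" using r1 by (simp add: cball_subset_ball_iff)
  then show ?thesis
    using branch(1)[OF pole_a] holomorphic_on_imp_continuous_on continuous_on_subset
    unfolding sect_def by blast
qed

lemma compact_D: "compact (D j)"
  unfolding D_def by (intro compact_continuous_image continuous_on_branch compact_cball)

lemma D_nonempty: "D j \<noteq> {}"
  using r1 by (auto simp: D_def)

lemma D_inverse:
  assumes "x \<in> D j" "\<not> is_pole f x"
  shows "x = branch (a j) (inverse (f x))" "norm (inverse (f x)) \<le> r1"
proof -
  obtain u where u: "norm u \<le> r1" "x = branch (a j) u" using assms by (auto simp: D_def)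
  have "inverse (f x) = u" using F_branch[OF pole_a, of u] u r1 by (simp add: F_def)
  then show "x = branch (a j) (inverse (f x))" "norm (inverse (f x)) \<le> r1" using u by auto
qed

lemma D_cover:
  assumes z: "\<not> is_pole f z" "norm (f z) \<ge> 1 / r1"
  obtains j where "z \<in> D j"
proof -
  have "2 / r0 < 1 / r1" using r1 r0 by (simp add: field_simps)
  then have "norm (f z) > 2 / r0" using z(2) by linarith
  then obtain p where p: "is_pole f p" "z = branch p (inverse (f z))"
    using branch_cover[OF z(1)] by blast
  obtain j where j: "p = a j" using poles p(1) unfolding bij_betw_def by auto
  have "inverse (norm (f z)) \<le> inverse (1 / r1)"
    using z(2) r1 by (intro le_imp_inverse_le) auto
  then have "inverse (f z) \<in> cball 0 r1" by (simp add: norm_inverse)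
  then show ?thesis using that[of j] p(2) unfolding D_def j by blast
qed

lemma dist_inverse: "x \<noteq> 0 \<Longrightarrow> y \<noteq> 0 \<Longrightarrow> dist (inverse x) (inverse y) = dist x y / (norm x * norm (y::complex))"
  by (simp add: dist_norm inverse_diff_inverse norm_mult norm_inverse norm_minus_commute divide_inverse mult_ac)

lemma eventually_a_large: "\<exists>N. \<forall>k\<ge>N. norm (a k) \<ge> M"
  using a_lim by (auto simp: filterlim_at_top eventually_sequentially)

text \<open>A point of the piece \<open>A j\<close> is mapped by \<open>f\<close> into some
  \<open>A k\<close> with \<open>k \<ge> N\<close>, and the inverse branch multiplies distances by
  at most \<open>8 * norm (b j) / (norm (a k))\<^sup>2\<close>. Summing over \<open>k\<close> halves
  the content bound, so iteration improves the trivial diameter bound by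
  \<open>(1/2)^n\<close>.\<close>

lemma hausdorff_null_large_orbit_set:
  assumes s: "s > 0" and summ: "summable (\<lambda>k. (norm (b k) / (norm (a k))\<^sup>2) powr s)"
  shows "\<exists>R0. \<forall>R\<ge>R0. hausdorff_measure s (large_orbit_set R f) = 0"
proof -
  \<comment> \<open>The \<open>8\<close> collects the factor \<open>2\<close> from
    \<open>bilip\<close> and two factors \<open>2\<close> from
    \<open>norm w \<ge> norm (a k) / 2\<close>, as inversion divides distances by a product of two
    norms.\<close>
  define c where "c k = (8 * (norm (b k) / (norm (a k))\<^sup>2)) powr s" for k
  have csum: "summable c"
    unfolding c_def powr_mult by (intro summable_mult summ)
  have c0: "c k \<ge> 0" for k by (simp add: c_def)
  \<comment> \<open>The bounds \<open>1\<close> and \<open>8 * B\<close> make the contraction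
    constants \<open>L\<close> at most \<open>1\<close>; \<open>4 * B * r1\<close> gives
    \<open>norm w \<ge> norm (a k) / 2\<close> on \<open>D k\<close>.\<close>
  define M where "M = max (max 1 (4 * B * r1)) (8 * B)"
  obtain N1 where N1: "\<And>k. k \<ge> N1 \<Longrightarrow> norm (a k) \<ge> M" using eventually_a_large by blast
  obtain N2 where N2: "\<And>n. n \<ge> N2 \<Longrightarrow> norm (\<Sum>i. c (i + n)) < 1 / 2"
    using suminf_exist_split[of "1/2", OF _ csum] by auto
  define N where "N = max N1 N2"
  have N: "norm (a k) \<ge> 1" "norm (a k) \<ge> 4 * B * r1" "norm (a k) \<ge> 8 * B" if "k \<ge> N" for k
    using N1[of k] that by (auto simp: N_def M_def)
  have csumN: "(\<Sum>i. c (i + N)) \<le> 1 / 2" using N2[of N] by (auto simp: N_def)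
  have csumN': "summable (\<lambda>i. c (i + N))" using csum by simp
  \<comment> \<open>The first bound puts every point of the orbit set into some \<open>D j\<close>,
    by looking at its image; the second excludes the pieces of index below \<open>N\<close>.\<close>
  define R0 where "R0 = max (1 / r1) (Max (insert 0 ((\<lambda>k. norm (a k)) ` {..<N})) + 2 * B * r1)"
  have "hausdorff_measure s (large_orbit_set R f) = 0" if R: "R \<ge> R0" for R
  proof -
    define J where "J = large_orbit_set R f"
    have J: "\<not> is_pole f z" "norm z > R" "f z \<in> J" if "z \<in> J" for z
    proof -
      have z: "\<And>k. \<not> is_pole f ((f ^^ k) z)" "\<And>k. norm ((f ^^ k) z) > R"
        using that by (auto simp: J_def large_orbit_set_def orbit_defined_def)
      show "\<not> is_pole f z" "norm z > R" using z[of 0] by auto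
      show "f z \<in> J"
        using z(1)[of "Suc _"] z(2)[of "Suc _"]
        by (auto simp: J_def large_orbit_set_def orbit_defined_def funpow_swap1)
    qed
    define A where "A j = J \<inter> D j" for j
    have cov: "J \<subseteq> (\<Union>j. A j)"
    proof
      fix z assume z: "z \<in> J"
      have "norm (f z) \<ge> 1 / r1" using J(2)[OF J(3)[OF z]] R by (auto simp: R0_def)
      then obtain j where "z \<in> D j" using D_cover J(1)[OF z] by blast
      then show "z \<in> (\<Union>j. A j)" using z by (auto simp: A_def)
    qed
    have A_N: "k \<ge> N" if "z \<in> A k" for z k
    proof (rule ccontr)
      assume "\<not> N \<le> k"
      then have "norm (a k) \<le> Max (insert 0 ((\<lambda>k. norm (a k)) ` {..<N}))" by (intro Max_ge) auto
      moreover have "norm z \<le> norm (a k) + 2 * B * r1" using that D_norm(2)[of z k] by (auto simp: A_def)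
      moreover have "norm z > R" using J that by (auto simp: A_def)
      ultimately show False using R by (auto simp: R0_def)
    qed
    have A_half: "norm w \<ge> norm (a k) / 2" if "w \<in> A k" for w k
      using D_norm(1)[of w k] N(2)[OF A_N[OF that]] that by (auto simp: A_def)
    \<comment> \<open>At this scale every piece is an admissible cover of itself, so the induction
      can start.\<close>
    define \<delta> where "\<delta> = 4 * B * r1 + 1"
    have \<delta>: "\<delta> > 0" using B0 r1 by (simp add: \<delta>_def add_pos_pos)
    define Q where "Q = (4 * r1) powr s"
    have main: "hausdorff_content s \<delta> (A j) \<le> ennreal (Q * norm (b j) powr s * (1/2)^n)" for j n
    proof (induction n arbitrary: j)
      case 0
      have d: "dist x y \<le> 4 * r1 * norm (b j)" if xy: "x \<in> A j" "y \<in> A j" for x y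
      proof -
        obtain u v where uv: "norm u \<le> r1" "norm v \<le> r1" "x = branch (a j) u" "y = branch (a j) v"
          using xy by (auto simp: A_def D_def)
        have "dist x y \<le> 2 * norm (b j) * dist u v" using bilip[OF uv(1,2), of j] uv by simp
        also have "\<dots> \<le> 2 * norm (b j) * (2 * r1)"
          using uv(1,2) norm_triangle_ineq4[of u v] by (intro mult_left_mono) (auto simp: dist_norm)
        finally show ?thesis by (simp add: mult_ac)
      qed
      have bd: "bounded (A j)"
        using compact_imp_bounded[OF compact_D] bounded_subset by (auto simp: A_def)
      have dA: "diameter (A j) \<le> 4 * r1 * norm (b j)"
        using d r1 by (intro diameter_le) (auto simp: dist_norm)
      also have "\<dots> \<le> 4 * r1 * B" using bB r1 by (intro mult_left_mono) auto
      also have "\<dots> \<le> \<delta>" by (simp add: \<delta>_def mult_ac)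
      finally have "hausdorff_content s \<delta> (A j) \<le> ennreal (diameter (A j) powr s)"
        by (intro hausdorff_content_le_diameter bd s)
      also have "\<dots> \<le> ennreal ((4 * r1 * norm (b j)) powr s)"
        using dA s diameter_ge_0[OF bd] by (intro ennreal_leI powr_mono2) auto
      finally show ?case by (simp add: Q_def powr_mult)
    next
      case (Suc n)
      define X where "X k = {z \<in> A j. f z \<in> A (k + N)}" for k
      have "A j \<subseteq> (\<Union>k. X k)"
      proof
        fix z assume z: "z \<in> A j"
        then have "f z \<in> J" using J(3) by (auto simp: A_def)
        then obtain k where k: "f z \<in> A k" using cov by blast
        then have "k \<ge> N" by (rule A_N)
        then show "z \<in> (\<Union>k. X k)" using z k by (intro UN_I[of "k - N"]) (auto simp: X_def)
      qed
      then have "hausdorff_content s \<delta> (A j) \<le> hausdorff_content s \<delta> (\<Union>k. X k)"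
        by (rule hausdorff_content_mono)
      also have "\<dots> \<le> (\<Sum>k. hausdorff_content s \<delta> (X k))" by (rule hausdorff_content_UN)
      also have "\<dots> \<le> (\<Sum>k. ennreal (Q * norm (b j) powr s * (1/2)^n * c (k + N)))"
      proof (intro suminf_le)
        fix k
        define ak where "ak = norm (a (k + N))"
        have ak: "ak \<ge> 1" "ak \<ge> 8 * B" using N[of "k + N"] by (auto simp: ak_def)
        define L where "L = 8 * norm (b j) / ak\<^sup>2"
        have L: "0 < L" using ak b0[of j] by (simp add: L_def)
        have "8 * norm (b j) \<le> ak * 1" using bB[of j] ak by simp
        also have "\<dots> \<le> ak * ak" using ak by (intro mult_left_mono) auto
        finally have L1: "L \<le> 1" using ak by (simp add: L_def power2_eq_square field_simps)
        \<comment> \<open>Pulling back produces covers at scale \<open>L * \<delta>\<close>; because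
          \<open>L \<le> 1\<close> these are also admissible at scale \<open>\<delta>\<close>, and
          the induction keeps its scale.\<close>
        have "hausdorff_content s \<delta> (X k) \<le> hausdorff_content s (L * \<delta>) (X k)"
          using L1 \<delta> L by (intro hausdorff_content_antimono) (simp add: mult_left_le_one_le)
        also have "\<dots> \<le> ennreal (L powr s) * hausdorff_content s \<delta> (f ` X k)"
        proof (rule hausdorff_content_expanding[OF s L])
          fix x y assume xy: "x \<in> X k" "y \<in> X k"
          have J': "x \<in> D j" "y \<in> D j" "\<not> is_pole f x" "\<not> is_pole f y"
            using xy J(1) by (auto simp: X_def A_def)
          have half: "norm (f x) \<ge> ak / 2" "norm (f y) \<ge> ak / 2"
            using xy A_half by (auto simp: X_def ak_def)
          then have nz: "f x \<noteq> 0" "f y \<noteq> 0" using ak by auto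
          have "dist x y \<le> 2 * norm (b j) * dist (inverse (f x)) (inverse (f y))"
            using bilip[OF D_inverse(2)[OF J'(1,3)] D_inverse(2)[OF J'(2,4)], of j]
              D_inverse(1)[OF J'(1,3)] D_inverse(1)[OF J'(2,4)] by simp
          also have "\<dots> = 2 * norm (b j) * (dist (f x) (f y) / (norm (f x) * norm (f y)))"
            using nz by (simp add: dist_inverse)
          also have "\<dots> \<le> 2 * norm (b j) * (dist (f x) (f y) / (ak / 2 * (ak / 2)))"
            using half ak nz by (intro mult_left_mono divide_left_mono mult_mono) (auto simp: zero_less_mult_iff)
          also have "\<dots> = L * dist (f x) (f y)" by (simp add: L_def power2_eq_square)
          finally show "dist x y \<le> L * dist (f x) (f y)" .
        qed
        also have "\<dots> \<le> ennreal (L powr s) * hausdorff_content s \<delta> (A (k + N))"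
          by (intro mult_left_mono hausdorff_content_mono) (auto simp: X_def)
        also have "\<dots> \<le> ennreal (L powr s) * ennreal (Q * norm (b (k + N)) powr s * (1/2)^n)"
          by (intro mult_left_mono Suc.IH) auto
        also have "\<dots> = ennreal (L powr s * (Q * norm (b (k + N)) powr s * (1/2)^n))"
          by (simp add: ennreal_mult' Q_def)
        also have "L powr s * (Q * norm (b (k + N)) powr s * (1/2)^n)
            = Q * (L * norm (b (k + N))) powr s * (1/2)^n"
          by (simp add: powr_mult)
        also have "L * norm (b (k + N)) = norm (b j) * (8 * (norm (b (k + N)) / ak\<^sup>2))"
          by (simp add: L_def)
        also have "Q * (norm (b j) * (8 * (norm (b (k + N)) / ak\<^sup>2))) powr s * (1/2)^n
            = Q * norm (b j) powr s * (1/2)^n * c (k + N)"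
          unfolding c_def ak_def by (subst powr_mult) (simp add: mult_ac)
        finally show "hausdorff_content s \<delta> (X k) \<le> ennreal (Q * norm (b j) powr s * (1/2)^n * c (k + N))" .
      qed auto
      also have "\<dots> = ennreal (\<Sum>k. Q * norm (b j) powr s * (1/2)^n * c (k + N))"
        using csumN' c0 by (intro suminf_ennreal2 summable_mult) (auto simp: Q_def)
      also have "(\<Sum>k. Q * norm (b j) powr s * (1/2)^n * c (k + N))
          = Q * norm (b j) powr s * (1/2)^n * (\<Sum>k. c (k + N))"
        using csumN' by (rule suminf_mult)
      also have "ennreal \<dots> \<le> ennreal (Q * norm (b j) powr s * (1/2)^n * (1/2))"
        using csumN by (intro ennreal_leI mult_left_mono) (auto simp: Q_def)
      finally show ?case by (simp add: mult_ac)
    qed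
    have "hausdorff_measure s (A j) = 0" for j
    proof -
      have "(\<lambda>n. Q * norm (b j) powr s * (1/2)^n) \<longlonglongrightarrow> Q * norm (b j) powr s * 0"
        by (intro tendsto_mult tendsto_const LIMSEQ_power_zero) auto
      then have "(\<lambda>n. ennreal (Q * norm (b j) powr s * (1/2)^n)) \<longlonglongrightarrow> ennreal 0"
        by (intro tendsto_ennrealI) simp
      then have "hausdorff_content s \<delta> (A j) \<le> ennreal 0"
        by (rule LIMSEQ_le_const) (use main in auto)
      then show ?thesis by (simp add: hausdorff_null_iff[OF s \<delta>])
    qed
    then have "hausdorff_measure s (\<Union>j. A j) = 0" using s by (intro hausdorff_null_UN) auto
    then show ?thesis using hausdorff_null_subset[OF _ cov s] by (simp add: J_def)
  qed
  then show ?thesis by blast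
qed

section \<open>Null sets under preimages, and the escaping set\<close>

lemma connected_nonpoles: "connected {z. \<not> is_pole f z}"
proof -
  have "{z. is_pole f z} = range a" using poles by (simp add: bij_betw_def)
  then have "countable {z. is_pole f z}" by simp
  from path_connected_complement_countable[OF _ this] show ?thesis
    by (simp add: path_connected_imp_connected Collect_neg_eq)
qed

lemma not_constant_nonpoles: "\<not> f constant_on {z. \<not> is_pole f z}"
proof
  assume "f constant_on {z. \<not> is_pole f z}"
  then obtain c where c: "\<And>z. \<not> is_pole f z \<Longrightarrow> f z = c" by (auto simp: constant_on_def)
  have "a 0 \<in> \<Omega>" using pole_a by (simp add: \<Omega>_def)
  then obtain S where S: "open S" "a 0 \<in> S" "\<forall>w\<in>S - {a 0}. \<not> is_pole f w" by (rule local_\<Omega>)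
  have "eventually (\<lambda>w. f w = c) (at (a 0))"
    using S c by (auto simp: eventually_at_topological)
  then have "frequently (\<lambda>w. f w = c) (at (a 0))" by (simp add: eventually_frequently)
  then show False using frequently_const_imp_not_is_pole pole_a by blast
qed

text \<open>The theorem on countability of zeros wants a nonconstant function on an F-sigma set; a
  constant derivative is handled apart and cannot be \<open>0\<close>, as \<open>f\<close> is not
  constant.\<close>

lemma countable_critical: "countable {z \<in> {z. \<not> is_pole f z}. deriv f z = 0}" (is "countable {z \<in> ?S. _}")
proof (cases "deriv f constant_on ?S")
  case False
  obtain \<D> where \<D>: "countable \<D>" "\<And>X. X \<in> \<D> \<Longrightarrow> \<exists>a b. X = cbox a b" "\<Union>\<D> = ?S"
    using open_countable_Union_open_cbox[OF open_nonpoles] by metis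
  have "?S \<noteq> {}" using not_constant_nonpoles by (auto simp: constant_on_def)
  then have ne: "\<D> \<noteq> {}" using \<D>(3) by auto
  have "fsigma (\<Union>(from_nat_into \<D> ` UNIV))"
    by (intro fsigma.intros) (metis \<D>(2) closed_cbox from_nat_into[OF ne])
  then have "fsigma ?S" using range_from_nat_into[OF ne \<D>(1)] \<D>(3) by simp
  then show ?thesis
    by (intro holomorphic_countable_zeros holomorphic_deriv holomorphic_nonpoles open_nonpoles
        connected_nonpoles False)
next
  case True
  then obtain c where c: "\<And>z. z \<in> ?S \<Longrightarrow> deriv f z = c" by (auto simp: constant_on_def)
  have "c \<noteq> 0"
  proof
    assume "c = 0"
    then have "f constant_on ?S"
      using c holomorphic_derivI[OF holomorphic_nonpoles open_nonpoles]
      by (intro has_field_derivative_0_imp_constant_on connected_nonpoles open_nonpoles) metis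
    then show False using not_constant_nonpoles by contradiction
  qed
  then have "{z \<in> ?S. deriv f z = 0} = {}" using c by auto
  then show ?thesis by (simp only: countable_empty)
qed

text \<open>Away from critical points \<open>f\<close> is locally bounded below in its distances, so
  nullity pulls back on small open sets, and countably many of these suffice by Lindelof. The
  critical points are countable, hence null.\<close>

lemma hausdorff_null_preimage:
  assumes E: "hausdorff_measure s E = 0" and s: "s > 0"
  shows "hausdorff_measure s {z. \<not> is_pole f z \<and> f z \<in> E} = 0"
proof -
  define S where "S = {z. \<not> is_pole f z}"
  define Z where "Z = {z \<in> S. deriv f z = 0}"
  define \<F> where "\<F> = {U. open U \<and> U \<subseteq> S \<and> (\<exists>L>0. \<forall>x\<in>U. \<forall>y\<in>U. dist x y \<le> L * dist (f x) (f y))}"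
  obtain \<F>' where F': "\<F>' \<subseteq> \<F>" "countable \<F>'" "\<Union>\<F>' = \<Union>\<F>"
    using Lindelof[of \<F>] by (auto simp: \<F>_def)
  have S: "open S" "f holomorphic_on S" using open_nonpoles holomorphic_nonpoles by (auto simp: S_def)
  have mem: "z \<in> \<Union>\<F>" if z: "z \<in> S" "deriv f z \<noteq> 0" for z
  proof -
    have "isCont (deriv f) z"
      using holomorphic_deriv[OF S(2,1)] S(1) z(1) continuous_on_eq_continuous_at
        holomorphic_on_imp_continuous_on by blast
    then obtain d where d: "d > 0" "\<And>w. dist w z < d \<Longrightarrow> dist (deriv f w) (deriv f z) < norm (deriv f z) / 2"
      using z(2) unfolding continuous_at_eps_delta by (metis half_gt_zero zero_less_norm_iff)
    obtain d' where d': "d' > 0" "ball z d' \<subseteq> S" using S(1) z(1) openE by blast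
    define U where "U = ball z (min d d')"
    have US: "U \<subseteq> S" using d' by (auto simp: U_def)
    have "dist x y \<le> 2 / norm (deriv f z) * dist (f x) (f y)" if "x \<in> U" "y \<in> U" for x y
    proof -
      have "norm (deriv f z) / 2 * dist x y \<le> dist (f x) (f y)"
      proof (rule bilipschitz_of_deriv_near(1)[of U])
        show "convex U" by (simp add: U_def)
        show "(f has_field_derivative deriv f w) (at w within U)" if "w \<in> U" for w
          by (rule has_field_derivative_at_within, rule holomorphic_derivI[OF S(2,1)]) (use US that in blast)
        show "norm (deriv f w - deriv f z) \<le> norm (deriv f z) / 2" if "w \<in> U" for w
          using d(2)[of w] that by (auto simp: U_def dist_norm norm_minus_commute)
      qed (use that in auto)
      then show ?thesis using z(2) by (simp add: field_simps)
    qed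
    moreover have "2 / norm (deriv f z) > 0" using z(2) by simp
    ultimately have "U \<in> \<F>" using US unfolding \<F>_def mem_Collect_eq
      by (intro conjI exI[of _ "2 / norm (deriv f z)"] ballI) (auto simp: U_def)
    moreover have "z \<in> U" using d d' by (simp add: U_def)
    ultimately show ?thesis by blast
  qed
  have "hausdorff_measure s (\<Union>U\<in>\<F>'. {z \<in> U. f z \<in> E}) = 0"
  proof (rule hausdorff_null_UN[OF F'(2) _ s])
    fix U assume "U \<in> \<F>'"
    then obtain L where L: "L > 0" "\<And>x y. x \<in> U \<Longrightarrow> y \<in> U \<Longrightarrow> dist x y \<le> L * dist (f x) (f y)"
      using F'(1) by (auto simp: \<F>_def)
    have "hausdorff_measure s (f ` {z \<in> U. f z \<in> E}) = 0"
      by (rule hausdorff_null_subset[OF E _ s]) auto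
    then show "hausdorff_measure s {z \<in> U. f z \<in> E} = 0"
      by (rule hausdorff_null_expanding[OF _ s L(1)]) (use L(2) in auto)
  qed
  moreover have "hausdorff_measure s Z = 0"
    using countable_critical s unfolding Z_def S_def by (rule hausdorff_null_countable)
  ultimately have "hausdorff_measure s (\<Union>i\<in>{True, False}. if i then Z else (\<Union>U\<in>\<F>'. {z \<in> U. f z \<in> E})) = 0"
    using s by (intro hausdorff_null_UN) auto
  then show ?thesis
  proof (rule hausdorff_null_subset[OF _ _ s])
    show "{z. \<not> is_pole f z \<and> f z \<in> E} \<subseteq> (\<Union>i\<in>{True, False}. if i then Z else (\<Union>U\<in>\<F>'. {z \<in> U. f z \<in> E}))"
    proof
      fix z assume z: "z \<in> {z. \<not> is_pole f z \<and> f z \<in> E}"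
      show "z \<in> (\<Union>i\<in>{True, False}. if i then Z else (\<Union>U\<in>\<F>'. {z \<in> U. f z \<in> E}))"
      proof (cases "deriv f z = 0")
        case True then show ?thesis using z by (simp add: Z_def S_def)
      next
        case False
        then have "z \<in> \<Union>\<F>'" using mem[of z] z F'(3) by (simp add: S_def)
        then show ?thesis using z by auto
      qed
    qed
  qed
qed

text \<open>Every escaping orbit eventually stays outside the disc of radius \<open>R\<close>, so
  the escaping set lies in the countable union of iterated preimages of the large orbit set.\<close>

lemma hausdorff_null_escaping_set:
  assumes s: "s > 0" and null: "hausdorff_measure s (large_orbit_set R f) = 0"
  shows "hausdorff_measure s (escaping_set f) = 0"
proof -
  define E where "E n = {z. orbit_defined f z \<and> (f ^^ n) z \<in> large_orbit_set R f}" for n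
  have E: "hausdorff_measure s (E n) = 0" for n
  proof (induction n)
    case 0
    show ?case by (rule hausdorff_null_subset[OF null _ s]) (auto simp: E_def)
  next
    case (Suc n)
    show ?case
    proof (rule hausdorff_null_subset[OF hausdorff_null_preimage[OF Suc s] _ s], safe)
      fix z assume z: "z \<in> E (Suc n)"
      then have o: "\<And>k. \<not> is_pole f ((f ^^ k) z)" by (simp add: E_def orbit_defined_def)
      show "f z \<in> E n"
        using z o[of "Suc _"] by (auto simp: E_def orbit_defined_def funpow_swap1)
      show False if "is_pole f z" using o[of 0] that by simp
    qed
  qed
  have "hausdorff_measure s (\<Union>n. E n) = 0" using E s by (intro hausdorff_null_UN) auto
  moreover have "escaping_set f \<subseteq> (\<Union>n. E n)"
  proof
    fix z assume "z \<in> escaping_set f"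
    then have o: "\<And>k. \<not> is_pole f ((f ^^ k) z)" and lim: "filterlim (\<lambda>n. (f ^^ n) z) at_infinity sequentially"
      by (auto simp: escaping_set_def orbit_defined_def)
    have "eventually (\<lambda>n. norm ((f ^^ n) z) \<ge> max 1 (R + 1)) sequentially"
      using lim filterlim_at_infinity[OF order_refl, of "\<lambda>n. (f ^^ n) z" sequentially]
      by (meson less_max_iff_disj zero_less_one)
    then obtain n where n: "\<And>k. k \<ge> n \<Longrightarrow> norm ((f ^^ k) z) \<ge> max 1 (R + 1)"
      by (auto simp: eventually_sequentially)
    have "(f ^^ n) z \<in> large_orbit_set R f"
      unfolding large_orbit_set_def orbit_defined_def
    proof (intro CollectI conjI allI)
      fix k
      have e: "(f ^^ k) ((f ^^ n) z) = (f ^^ (k + n)) z" by (simp add: funpow_add)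
      show "\<not> is_pole f ((f ^^ k) ((f ^^ n) z))" unfolding e by (rule o)
      show "norm ((f ^^ k) ((f ^^ n) z)) > R" unfolding e using n[of "k + n"] by simp
    qed
    then show "z \<in> (\<Union>n. E n)" using o by (auto simp: E_def orbit_defined_def)
  qed
  ultimately show ?thesis by (rule hausdorff_null_subset[OF _ _ s])
qed

end

section \<open>Lower bound\<close>

text \<open>However fast \<open>\<Gamma>\<close> decays, repeating each index long enough lets the
  sequence still tend to infinity while \<open>\<Gamma> (q n)\<close> loses at most a geometric
  factor.\<close>

lemma slowly_growing_index:
  fixes \<Gamma> :: "nat \<Rightarrow> real"
  assumes \<Gamma>: "\<And>p. \<Gamma> p > 0"
  obtains c :: real and q :: "nat \<Rightarrow> nat"
  where "c > 0" "filterlim q at_top sequentially" "\<And>n. c * (1/2) ^ n \<le> \<Gamma> (q n)"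
proof -
  \<comment> \<open>The index \<open>0\<close> always qualifies, and \<open>p \<le> n\<close> keeps
    the set finite, so that its maximum exists.\<close>
  define S where "S n = {p. p \<le> n \<and> \<Gamma> 0 * (1/2) ^ n \<le> \<Gamma> p}" for n
  define q where "q n = Max (S n)" for n
  have fin: "finite (S n)" for n by (auto simp: S_def)
  have "\<Gamma> 0 * (1/2) ^ n \<le> \<Gamma> 0" for n
    using \<Gamma>[of 0] by (simp add: mult_left_le power_le_one)
  then have ne: "S n \<noteq> {}" for n by (auto simp: S_def)
  have q: "q n \<in> S n" for n unfolding q_def by (rule Max_in[OF fin ne])
  have "eventually (\<lambda>n. p \<le> q n) sequentially" for p
  proof -
    have "(\<lambda>n. \<Gamma> 0 * (1/2) ^ n) \<longlonglongrightarrow> \<Gamma> 0 * 0"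
      by (intro tendsto_mult tendsto_const LIMSEQ_power_zero) auto
    then have "eventually (\<lambda>n. \<Gamma> 0 * (1/2) ^ n < \<Gamma> p) sequentially"
      using \<Gamma>[of p] by (intro order_tendstoD(2)[of _ "\<Gamma> 0 * 0"]) auto
    then show ?thesis using eventually_ge_at_top[of p]
      by eventually_elim (use fin in \<open>auto simp: q_def S_def intro!: Max_ge\<close>)
  qed
  then have "filterlim q at_top sequentially" by (simp add: filterlim_at_top)
  then show ?thesis using that[of "\<Gamma> 0" q] \<Gamma> q by (auto simp: S_def)
qed

text \<open>The quantifier over all \<open>e \<le> d\<close> in the hypothesis allows passing to the
  minimum over finitely many pairs.\<close>

lemma finite_separated:
  assumes fin: "finite E" and P: "\<And>k l. k \<in> E \<Longrightarrow> l \<in> E \<Longrightarrow> k \<noteq> l \<Longrightarrow> \<exists>d>0. \<forall>e\<le>d. P k l (e::real)"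
  shows "\<exists>d>0. \<forall>k\<in>E. \<forall>l\<in>E. k \<noteq> l \<longrightarrow> P k l d"
proof -
  obtain g where g: "\<And>k l. k \<in> E \<Longrightarrow> l \<in> E \<Longrightarrow> k \<noteq> l \<Longrightarrow> g k l > 0 \<and> (\<forall>e\<le>g k l. P k l e)"
    using P by metis
  \<comment> \<open>The extra element \<open>1\<close> keeps the set nonempty when \<open>E\<close>
    has no two distinct elements.\<close>
  define A where "A = insert 1 ((\<lambda>(k, l). g k l) ` {(k, l) \<in> E \<times> E. k \<noteq> l})"
  have "finite ((\<lambda>(k, l). g k l) ` {(k, l) \<in> E \<times> E. k \<noteq> l})"
    by (intro finite_imageI finite_subset[OF _ finite_cartesian_product[OF fin fin]]) auto
  then have A: "finite A" "A \<noteq> {}" "\<And>x. x \<in> A \<Longrightarrow> x > 0" using g by (auto simp: A_def)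
  have "Min A > 0" using A by simp
  moreover have "P k l (Min A)" if "k \<in> E" "l \<in> E" "k \<noteq> l" for k l
  proof -
    have "g k l \<in> A" using that unfolding A_def by auto
    then have "Min A \<le> g k l" using A by simp
    then show ?thesis using g[OF that] by blast
  qed
  ultimately show ?thesis by blast
qed

lemma not_summable_block:
  fixes g :: "nat \<Rightarrow> real"
  assumes "\<not> summable g" "\<And>n. g n \<ge> 0"
  obtains E where "finite E" "E \<subseteq> {N..}" "sum g E \<ge> M"
proof -
  have "\<not> summable (\<lambda>i. g (i + N))" using assms by simp
  then have "\<not> (\<forall>n. (\<Sum>i<n. g (i + N)) \<le> M)"
    using summableI_nonneg_bounded[of "\<lambda>i. g (i + N)" M] assms(2) by blast
  then obtain n where "(\<Sum>i<n. g (i + N)) \<ge> M" by (meson less_imp_le not_le)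
  moreover have "(\<Sum>i<n. g (i + N)) = sum g ((\<lambda>i. i + N) ` {..<n})"
    by (subst sum.reindex) auto
  ultimately show ?thesis by (intro that[of "(\<lambda>i. i + N) ` {..<n}"]) auto
qed

context pole_data
begin

text \<open>Disjoint compact sets have positive distance. The statement concerns inverses because
  the branches are functions of \<open>1/w\<close>.\<close>

lemma inverse_D_separated:
  assumes "finite E" "\<And>k x. k \<in> E \<Longrightarrow> x \<in> D k \<Longrightarrow> x \<noteq> 0"
  obtains \<gamma> where "\<gamma> > 0"
    "\<And>k l x y. k \<in> E \<Longrightarrow> l \<in> E \<Longrightarrow> k \<noteq> l \<Longrightarrow> x \<in> D k \<Longrightarrow> y \<in> D l \<Longrightarrow> \<gamma> \<le> dist (inverse x) (inverse y)"
proof -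
  have comp: "compact (inverse ` D k)" if "k \<in> E" for k
    using assms(2) that by (intro compact_continuous_image continuous_intros compact_D) auto
  have "\<exists>d>0. \<forall>e\<le>d. \<forall>x\<in>D k. \<forall>y\<in>D l. e \<le> dist (inverse x) (inverse y)"
    if kl: "k \<in> E" "l \<in> E" "k \<noteq> l" for k l
  proof -
    have "inverse ` D k \<inter> inverse ` D l = {}"
      using D_disjoint kl(3) by (auto simp: inverse_eq_iff_eq)
    then obtain d where "d > 0" "\<forall>x\<in>inverse ` D k. \<forall>y\<in>inverse ` D l. d \<le> dist x y"
      using separate_compact_closed[OF comp[OF kl(1)] compact_imp_closed[OF comp[OF kl(2)]]] by blast
    then show ?thesis by (intro exI[of _ d]) (auto intro: order_trans)
  qed
  from finite_separated[OF assms(1), where P = "\<lambda>k l e. \<forall>x\<in>D k. \<forall>y\<in>D l. e \<le> dist (inverse x) (inverse y)", OF this]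
  have "\<exists>d>0. \<forall>k\<in>E. \<forall>l\<in>E. k \<noteq> l \<longrightarrow> (\<forall>x\<in>D k. \<forall>y\<in>D l. d \<le> dist (inverse x) (inverse y))" .
  then show ?thesis using that by blast
qed

text \<open>The nested cells are built from blocks \<open>E p\<close> of poles whose sums are at
  least \<open>2\<close>. This factor pays for the decay of \<open>v n = c * (1/2) ^ n\<close>,
  which in turn accommodates the unknown gaps between the poles of a block.\<close>

lemma hausdorff_measure_escaping_nonzero:
  assumes s: "s > 0" and nsum: "\<not> summable (\<lambda>k. (norm (b k) / (norm (a k))\<^sup>2) powr s)"
  shows "hausdorff_measure s (escaping_set f \<inter> large_orbit_set R f) \<noteq> 0"
proof -
  \<comment> \<open>\<open>\<alpha> k\<close> bounds the scaling of inversion on \<open>D k\<close>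
    from below, where norms are at most \<open>2 * norm (a k)\<close>; \<open>\<beta> j\<close> does
    the same for the branch at \<open>a j\<close>.\<close>
  define \<alpha> \<beta> where "\<alpha> k = 1 / (4 * (norm (a k))\<^sup>2)" and "\<beta> k = norm (b k) / 2" for k
  define G where "G j w = branch (a j) (inverse w)" for j w
  have \<beta>0: "\<beta> j > 0" for j using b0[of j] by (simp add: \<beta>_def)
  \<comment> \<open>In turn, the four bounds give on \<open>D k\<close> that
    \<open>norm x \<le> 2 * norm (a k)\<close>, that \<open>norm x > R\<close>, and that
    \<open>inverse x\<close> has norm at most \<open>r1\<close>; the last one yields
    \<open>\<beta> j * \<alpha> k \<le> 1 / 2\<close> and \<open>a k \<noteq> 0\<close>.\<close>
  define M where "M = max (max (4 * B * r1 + 1) (R + 2 * B * r1 + 1)) (max (1 / r1 + 2 * B * r1) (B + 1))"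
  obtain N where N: "\<And>k. k \<ge> N \<Longrightarrow> norm (a k) \<ge> M" using eventually_a_large by blast
  have aN: "norm (a k) \<ge> 4 * B * r1 + 1" "norm (a k) \<ge> R + 2 * B * r1 + 1"
     "norm (a k) \<ge> 1 / r1 + 2 * B * r1" "norm (a k) \<ge> B + 1" if "k \<ge> N" for k
    using N[OF that] by (auto simp: M_def)
  have Br: "B * r1 > 0" using B0 r1 by simp
  have DN: "norm x > R" "norm x \<ge> 1 / r1" "norm x \<le> 2 * norm (a k)" "x \<noteq> 0" if "k \<ge> N" "x \<in> D k" for k x
  proof -
    show 1: "norm x > R" "norm x \<ge> 1 / r1" "norm x \<le> 2 * norm (a k)"
      using D_norm[OF that(2)] aN[OF that(1)] Br by linarith+
    have "1 / r1 > 0" using r1 by simp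
    then have "norm x > 0" using 1(2) by linarith
    then show "x \<noteq> 0" by simp
  qed
  have inv_r1: "norm (inverse x) \<le> r1" if "k \<ge> N" "x \<in> D k" for k x
  proof -
    have "inverse (norm x) \<le> inverse (1 / r1)"
      using DN[OF that] r1 by (intro le_imp_inverse_le) auto
    then show ?thesis by (simp add: norm_inverse)
  qed
  have dist_G: "\<beta> j * dist (inverse x) (inverse y) \<le> dist (G j x) (G j y)"
    if "k \<ge> N" "x \<in> D k" "l \<ge> N" "y \<in> D l" for j k l x y
    using bilip[OF inv_r1[OF that(1,2)] inv_r1[OF that(3,4)], of j] by (simp add: G_def \<beta>_def)
  have \<alpha>0: "\<alpha> k > 0" if "k \<ge> N" for k
  proof -
    have "norm (a k) > 0" using aN(4)[OF that] B0 by linarith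
    then show ?thesis by (simp add: \<alpha>_def)
  qed
  have ns: "\<not> summable (\<lambda>k. (\<alpha> k * \<beta> k) powr s)"
  proof
    assume "summable (\<lambda>k. (\<alpha> k * \<beta> k) powr s)"
    then have "summable (\<lambda>k. 8 powr s * (\<alpha> k * \<beta> k) powr s)" by (rule summable_mult)
    also have "(\<lambda>k. 8 powr s * (\<alpha> k * \<beta> k) powr s) = (\<lambda>k. (norm (b k) / (norm (a k))\<^sup>2) powr s)"
      by (simp add: \<alpha>_def \<beta>_def powr_mult[symmetric])
    finally show False using nsum by contradiction
  qed
  have "\<exists>E. finite E \<and> E \<subseteq> {N + p..} \<and> 2 \<le> (\<Sum>k\<in>E. (\<alpha> k * \<beta> k) powr s)" for p
    using not_summable_block[OF ns, of "N + p" 2] by (metis powr_ge_zero)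
  then obtain E where E: "\<And>p. finite (E p)" "\<And>p. E p \<subseteq> {N + p..}"
      "\<And>p. 2 \<le> (\<Sum>k\<in>E p. (\<alpha> k * \<beta> k) powr s)" by metis
  have EN: "k \<ge> N" "k \<ge> p" if "k \<in> E p" for k p using E(2)[of p] that by auto
  have Ene: "E p \<noteq> {}" for p using E(3)[of p] by auto
  have "\<exists>\<gamma>>0. \<forall>k\<in>E p. \<forall>l\<in>E p. k \<noteq> l \<longrightarrow> (\<forall>x\<in>D k. \<forall>y\<in>D l. \<gamma> \<le> dist (inverse x) (inverse y))" for p
    using inverse_D_separated[OF E(1)[of p]] DN(4) EN(1) by metis
  then obtain \<gamma> where \<gamma>: "\<And>p. \<gamma> p > 0"
     "\<And>p k l x y. k \<in> E p \<Longrightarrow> l \<in> E p \<Longrightarrow> k \<noteq> l \<Longrightarrow> x \<in> D k \<Longrightarrow> y \<in> D l \<Longrightarrow> \<gamma> p \<le> dist (inverse x) (inverse y)"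
    by metis
  obtain c q where cq: "c > 0" "filterlim q at_top sequentially" "\<And>n. c * (1/2) ^ n \<le> \<gamma> (q n) powr s"
    using slowly_growing_index[of "\<lambda>p. \<gamma> p powr s"] \<gamma>(1) by (metis powr_gt_zero less_irrefl)
  \<comment> \<open>The shift matches the gap at step \<open>n\<close> with the children, which
    belong to the block \<open>E (Q (Suc n)) = E (q n)\<close>. The initial block is
    arbitrary.\<close>
  define Q where "Q n = (case n of 0 \<Rightarrow> 0 | Suc n \<Rightarrow> q n)" for n
  have Q_lim: "filterlim Q at_top sequentially"
    using cq(2) by (subst filterlim_sequentially_Suc[symmetric]) (simp add: Q_def)
  define K where "K = {z. \<exists>w. \<forall>n. w n \<in> E (Q n) \<and> (f ^^ n) z \<in> D (w n)}"
  have "hausdorff_measure s K \<noteq> 0"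
    unfolding K_def
  proof (rule hausdorff_measure_cells_nonzero[where G = G and \<alpha> = \<alpha> and \<beta> = \<beta> and B = B
        and \<gamma> = "\<lambda>n. \<gamma> (q n)" and v = "\<lambda>n. c * (1/2) ^ n"])
    show "compact (D j)" for j by (rule compact_D)
    show "D j \<noteq> {}" for j by (rule D_nonempty)
    show "G j y \<in> D j \<and> f (G j y) = y" if "j \<in> E (Q n)" "k \<in> E (Q (Suc n))" "y \<in> D k" for n j k y
    proof -
      have y: "norm (inverse y) \<le> r1" "y \<noteq> 0" using inv_r1 DN(4) EN(1)[OF that(2)] that(3) by blast+
      have "f (G j y) = inverse (inverse y)"
        unfolding G_def by (rule branch_nonpole(2)[OF pole_a]) (use y r1 in auto)
      moreover have "G j y \<in> D j" using y(1) by (simp add: G_def D_def)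
      ultimately show ?thesis by simp
    qed
    show "continuous_on (D k) (G j)" if "j \<in> E (Q n)" "k \<in> E (Q (Suc n))" for n j k
      unfolding G_def
    proof (rule continuous_on_compose2[OF continuous_on_branch])
      show "continuous_on (D k) inverse"
        using DN(4)[OF EN(1)[OF that(2)]] by (intro continuous_intros) auto
      show "inverse ` D k \<subseteq> cball 0 r1" using inv_r1[OF EN(1)[OF that(2)]] by auto
    qed
    show "\<beta> j * \<gamma> (q n) \<le> dist (G j x) (G j y)"
      if "j \<in> E (Q n)" "k \<in> E (Q (Suc n))" "l \<in> E (Q (Suc n))" "k \<noteq> l" "x \<in> D k" "y \<in> D l" for n j k l x y
    proof -
      have "\<gamma> (q n) \<le> dist (inverse x) (inverse y)"
        using that by (intro \<gamma>(2)[of k _ l]) (auto simp: Q_def)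
      then have "\<beta> j * \<gamma> (q n) \<le> \<beta> j * dist (inverse x) (inverse y)"
        using \<beta>0[of j] by (intro mult_left_mono) auto
      also have "\<dots> \<le> dist (G j x) (G j y)"
        by (rule dist_G[OF EN(1)[OF that(2)] that(5) EN(1)[OF that(3)] that(6)])
      finally show ?thesis .
    qed
    show "\<beta> j * \<alpha> k * dist x y \<le> dist (G j x) (G j y)"
      if "j \<in> E (Q n)" "k \<in> E (Q (Suc n))" "x \<in> D k" "y \<in> D k" for n j k x y
    proof -
      have k: "k \<ge> N" using EN that by blast
      note x = DN(3,4)[OF k that(3)] and y = DN(3,4)[OF k that(4)]
      have "dist x y / (4 * (norm (a k))\<^sup>2) \<le> dist x y / (norm x * norm y)"
      proof (rule divide_left_mono)
        show "norm x * norm y \<le> 4 * (norm (a k))\<^sup>2"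
          using mult_mono[OF x(1) y(1)] by (simp add: power2_eq_square)
        show "0 < 4 * (norm (a k))\<^sup>2 * (norm x * norm y)"
          using x y \<alpha>0[OF k] by (auto simp: \<alpha>_def)
      qed simp
      then have "\<beta> j * (\<alpha> k * dist x y) \<le> \<beta> j * dist (inverse x) (inverse y)"
        using x y \<beta>0[of j] by (intro mult_left_mono) (auto simp: dist_inverse \<alpha>_def)
      also have "\<dots> \<le> dist (G j x) (G j y)" by (rule dist_G[OF k that(3) k that(4)])
      finally show ?thesis by (simp add: mult_ac)
    qed
    show "0 < \<beta> j \<and> \<beta> j \<le> B" for j
      using \<beta>0 bB[of j] norm_ge_zero[of "b j"] by (auto simp: \<beta>_def simp del: norm_ge_zero)
    show "0 < \<alpha> k \<and> \<beta> j * \<alpha> k \<le> 1 / 2" if "j \<in> E (Q n)" "k \<in> E (Q (Suc n))" for n j k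
    proof -
      have k: "k \<ge> N" using EN that by blast
      have a1: "norm (a k) \<ge> 1" "norm (a k) \<ge> B" using aN(4)[OF k] B0 by auto
      have "norm (b j) \<le> norm (a k) * 1" using bB[of j] a1 by linarith
      also have "\<dots> \<le> norm (a k) * norm (a k)" using a1 by (intro mult_left_mono) auto
      also have "\<dots> \<le> 4 * (norm (a k))\<^sup>2" by (simp add: power2_eq_square)
      finally have "norm (b j) / (4 * (norm (a k))\<^sup>2) \<le> 1"
        by (intro divide_le_eq_1[THEN iffD2]) auto
      then have "\<beta> j * \<alpha> k \<le> 1 / 2" by (simp add: \<alpha>_def \<beta>_def)
      then show ?thesis using \<alpha>0[OF k] by simp
    qed
    show "c * (1/2) ^ n \<le> c * (1/2) ^ Suc n * (\<Sum>k\<in>E (Q (Suc n)). (\<alpha> k * \<beta> k) powr s)" for n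
    proof -
      have "c * (1/2) ^ Suc n * 2 \<le> c * (1/2) ^ Suc n * (\<Sum>k\<in>E (Q (Suc n)). (\<alpha> k * \<beta> k) powr s)"
        using cq(1) by (intro mult_left_mono E(3)) auto
      then show ?thesis by simp
    qed
    show "c * (1 / 2) ^ n \<le> c * (1 / 2) ^ 0" for n
      using cq(1) by (simp add: mult_left_le power_le_one)
  qed (use E(1) Ene s cq \<gamma>(1) in auto)
  moreover have "K \<subseteq> escaping_set f \<inter> large_orbit_set R f"
  proof
    fix z assume "z \<in> K"
    then obtain w where w: "\<And>n. w n \<in> E (Q n)" "\<And>n. (f ^^ n) z \<in> D (w n)" by (auto simp: K_def)
    have wN: "w n \<ge> N" "w n \<ge> Q n" for n using EN w(1) by blast+
    \<comment> \<open>At a pole the dummy value would make the next iterate \<open>0\<close>, but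
      that iterate lies in some \<open>D k\<close> with \<open>k \<ge> N\<close>, which omits
      \<open>0\<close>.\<close>
    have np: "\<not> is_pole f ((f ^^ n) z)" for n
      using pole_zero[of "(f ^^ n) z"] DN(4)[OF wN(1) w(2), of "Suc n"] by auto
    then have od: "orbit_defined f z" by (simp add: orbit_defined_def)
    have "filterlim w at_top sequentially"
      by (rule filterlim_at_top_mono[OF Q_lim]) (use wN in auto)
    then have "filterlim (\<lambda>n. norm (a (w n))) at_top sequentially"
      by (rule filterlim_compose[OF a_lim])
    then have "filterlim (\<lambda>n. - (2 * B * r1) + norm (a (w n))) at_top sequentially"
      by (rule filterlim_tendsto_add_at_top[OF tendsto_const])
    then have "filterlim (\<lambda>n. norm ((f ^^ n) z)) at_top sequentially"
      by (rule filterlim_at_top_mono) (use D_norm(1)[OF w(2)] in \<open>auto simp: algebra_simps intro!: always_eventually\<close>)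
    then have "filterlim (\<lambda>n. (f ^^ n) z) at_infinity sequentially"
      by (rule filterlim_norm_at_top_imp_at_infinity)
    moreover have "norm ((f ^^ n) z) > R" for n using DN(1)[OF wN(1) w(2)] .
    ultimately show "z \<in> escaping_set f \<inter> large_orbit_set R f"
      using od by (simp add: escaping_set_def large_orbit_set_def)
  qed
  ultimately show ?thesis using hausdorff_null_subset s by blast
qed

end

section \<open>The critical exponent of the series\<close>

text \<open>Up to constant factors the terms are powers of \<open>j\<close> with exponent
  \<open>- s * (m + 4) / (m + 2)\<close>: the residues contribute \<open>m / (m + 2)\<close> and the
  squared poles \<open>4 / (m + 2)\<close>.\<close>

lemma summable_pole_series_iff:
  fixes a b :: "nat \<Rightarrow> complex" and C s :: real and m :: nat
  assumes C: "C \<ge> 1" and s: "s > 0"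
    and a: "\<forall>\<^sub>F j in sequentially.
           inverse C * real j powr (2 / (real m + 2)) \<le> norm (a j) \<and>
           norm (a j) \<le> C * real j powr (2 / (real m + 2))"
    and b: "\<forall>\<^sub>F j in sequentially.
           inverse C * real j powr (- real m / (real m + 2)) \<le> norm (b j) \<and>
           norm (b j) \<le> C * real j powr (- real m / (real m + 2))"
  shows "summable (\<lambda>j. (norm (b j) / (norm (a j))\<^sup>2) powr s) \<longleftrightarrow> (real m + 2) / (real m + 4) < s"
proof -
  define e where "e = - (s * (real m + 4) / (real m + 2))"
  have m: "real m + 2 > 0" "real m + 4 > 0" by auto
  have bounds: "\<forall>\<^sub>F j in sequentially. (inverse C ^ 3) powr s * real j powr e \<le> (norm (b j) / (norm (a j))\<^sup>2) powr s \<and>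
       (norm (b j) / (norm (a j))\<^sup>2) powr s \<le> (C ^ 3) powr s * real j powr e"
    using a b eventually_gt_at_top[of 0]
  proof eventually_elim
    case (elim j)
    define x y where "x = real j powr (2 / (real m + 2))" and "y = real j powr (- real m / (real m + 2))"
    have xy: "x > 0" "y > 0" using elim by (auto simp: x_def y_def)
    have e: "(y / x\<^sup>2) powr s = real j powr e"
    proof -
      have "x\<^sup>2 = real j powr (4 / (real m + 2))"
        by (simp add: x_def power2_eq_square powr_add[symmetric] add_divide_distrib[symmetric])
      then have "y / x\<^sup>2 = real j powr (- real m / (real m + 2) - 4 / (real m + 2))"
        by (simp add: y_def powr_diff)
      also have "- real m / (real m + 2) - 4 / (real m + 2) = - ((real m + 4) / (real m + 2))"
        unfolding diff_divide_distrib[symmetric] minus_divide_left by simp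
      finally show ?thesis by (simp add: powr_powr e_def mult_ac)
    qed
    have ax: "inverse C * x \<le> norm (a j)" "norm (a j) \<le> C * x"
      and bx: "inverse C * y \<le> norm (b j)" "norm (b j) \<le> C * y"
      using elim by (auto simp: x_def y_def)
    have ap: "norm (a j) > 0" using ax(1) xy C
      by (metis inverse_positive_iff_positive less_le_trans mult_pos_pos zero_less_one)
    have "inverse C ^ 3 * (y / x\<^sup>2) = inverse C * y / (C * x)\<^sup>2"
      by (simp add: power2_eq_square power3_eq_cube divide_inverse mult_ac)
    also have "\<dots> \<le> norm (b j) / (norm (a j))\<^sup>2"
      using ax bx xy C ap by (intro frac_le power_mono) auto
    finally have 1: "inverse C ^ 3 * (y / x\<^sup>2) \<le> norm (b j) / (norm (a j))\<^sup>2" .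
    have "norm (b j) / (norm (a j))\<^sup>2 \<le> C * y / (inverse C * x)\<^sup>2"
      using ax bx xy C ap by (intro frac_le power_mono) auto
    also have "\<dots> = C ^ 3 * (y / x\<^sup>2)"
      by (simp add: power2_eq_square power3_eq_cube divide_inverse mult_ac)
    finally have 2: "norm (b j) / (norm (a j))\<^sup>2 \<le> C ^ 3 * (y / x\<^sup>2)" .
    have "(inverse C ^ 3 * (y / x\<^sup>2)) powr s \<le> (norm (b j) / (norm (a j))\<^sup>2) powr s"
      using 1 s xy C by (intro powr_mono2) auto
    moreover have "(norm (b j) / (norm (a j))\<^sup>2) powr s \<le> (C ^ 3 * (y / x\<^sup>2)) powr s"
      using 2 s by (intro powr_mono2) auto
    ultimately show ?case unfolding powr_mult e by blast
  qed
  have "summable (\<lambda>j. (norm (b j) / (norm (a j))\<^sup>2) powr s) \<longleftrightarrow> summable (\<lambda>j. real j powr e)"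
  proof
    assume "summable (\<lambda>j. (norm (b j) / (norm (a j))\<^sup>2) powr s)"
    then have "summable (\<lambda>j. (inverse C ^ 3) powr s * real j powr e)"
      by (rule summable_comparison_test_ev[rotated]) (use bounds in eventually_elim, auto)
    moreover have "(inverse C ^ 3) powr s \<noteq> 0" using C by auto
    ultimately show "summable (\<lambda>j. real j powr e)" by (simp add: summable_cmult_iff)
  next
    assume "summable (\<lambda>j. real j powr e)"
    then have "summable (\<lambda>j. (C ^ 3) powr s * real j powr e)" by (rule summable_mult)
    then show "summable (\<lambda>j. (norm (b j) / (norm (a j))\<^sup>2) powr s)"
      by (rule summable_comparison_test_ev[rotated]) (use bounds in eventually_elim, auto)
  qed
  also have "\<dots> \<longleftrightarrow> e < - 1" by (rule summable_real_powr_iff)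
  also have "\<dots> \<longleftrightarrow> (real m + 2) / (real m + 4) < s" using m by (simp add: e_def field_simps)
  finally show ?thesis .
qed

section \<open>Both dimensions from the critical exponent\<close>

theorem theorem3:
  fixes m :: nat and f :: "complex \<Rightarrow> complex" and a b :: "nat \<Rightarrow> complex" and C :: real
  assumes "transcendental_meromorphic f"
    and "f \<in> eremenko_lyubich_class"
    and "\<not> singular_value f None"
    and "bij_betw a UNIV {z. is_pole f z}"
    and "\<And>j. norm (a j) \<le> norm (a (Suc j))"
    and "\<And>j. b j = residue f (a j)"
    and "C \<ge> 1"
    and "\<forall>\<^sub>F j in sequentially.
           inverse C * real j powr (2 / (real m + 2)) \<le> norm (a j) \<and>
           norm (a j) \<le> C * real j powr (2 / (real m + 2))"
    and "\<forall>\<^sub>F j in sequentially.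
           inverse C * real j powr (- real m / (real m + 2)) \<le> norm (b j) \<and>
           norm (b j) \<le> C * real j powr (- real m / (real m + 2))"
  shows "hausdorff_dim (escaping_set f) = ereal ((real m + 2) / (real m + 4)) \<and>
         ((\<lambda>R. hausdorff_dim (large_orbit_set R f)) \<longlongrightarrow> ereal ((real m + 2) / (real m + 4))) at_top"
proof -
  define d where "d = (real m + 2) / (real m + 4)"
  have d: "d > 0" by (simp add: d_def add_pos_pos)
  have mero: "f nicely_meromorphic_on UNIV" and bdd: "bounded {w. singular_value f (Some w)}"
    using assms(2) by (auto simp: eremenko_lyubich_class_def)
  obtain B0 where B0: "B0 > 0" "\<And>w. singular_value f (Some w) \<Longrightarrow> norm w \<le> B0"
    using bdd unfolding bounded_pos by auto
  define r0 where "r0 = 1 / B0"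
  have r0: "r0 > 0" using B0 by (simp add: r0_def)
  interpret no_large_singular_values f r0
    by unfold_locales (use mero r0 assms(3) B0 in \<open>force simp: r0_def\<close>)+
  obtain \<epsilon> where \<epsilon>: "0 < \<epsilon>" "\<epsilon> \<le> 1/4"
    "\<And>\<phi> r u v. r > 0 \<Longrightarrow> \<phi> holomorphic_on ball 0 r \<Longrightarrow> inj_on \<phi> (ball 0 r) \<Longrightarrow>
       norm u \<le> \<epsilon> * r \<Longrightarrow> norm v \<le> \<epsilon> * r \<Longrightarrow>
       norm (deriv \<phi> 0) / 2 * dist u v \<le> dist (\<phi> u) (\<phi> v) \<and>
       dist (\<phi> u) (\<phi> v) \<le> 2 * norm (deriv \<phi> 0) * dist u v"
    using univalent_bilipschitz by metis
  have pole: "is_pole f (a j)" for j using bij_betwE[OF assms(4)] by auto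
  have hol: "branch (a j) holomorphic_on ball 0 r0" for j
    using branch(1)[OF pole] by (simp add: sect_def)
  have der: "deriv (branch (a j)) 0 = b j" for j
    using deriv_branch[OF pole] assms(6) by simp
  have "eventually (\<lambda>j. norm (b j) \<le> C) sequentially"
    using assms(9) eventually_gt_at_top[of 0]
  proof eventually_elim
    case (elim j)
    have "real j powr (- real m / (real m + 2)) \<le> real j powr 0"
      using elim by (intro powr_mono) (auto simp: divide_nonpos_pos)
    then have "C * real j powr (- real m / (real m + 2)) \<le> C * 1"
      using elim assms(7) by (intro mult_left_mono) auto
    then show ?case using elim by simp
  qed
  \<comment> \<open>The asymptotic hypothesis bounds only the residues of large index; boundedness
    of the sequence covers the remaining finitely many.\<close>
  then have "Bseq b" by (rule BfunI)
  then obtain B where B: "\<And>j. norm (b j) \<le> B" unfolding Bseq_def by blast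
  have "filterlim (\<lambda>j. real j powr (2 / (real m + 2))) at_top sequentially"
    by (rule filterlim_compose[OF real_powr_at_top filterlim_real_sequentially]) simp
  then have "filterlim (\<lambda>j. inverse C * real j powr (2 / (real m + 2))) at_top sequentially"
    using assms(7) by (intro filterlim_tendsto_pos_mult_at_top[OF tendsto_const]) auto
  then have a_lim: "filterlim (\<lambda>j. norm (a j)) at_top sequentially"
    by (rule filterlim_at_top_mono) (use assms(8) in eventually_elim, auto)
  interpret pole_data f r0 a b "\<epsilon> * r0" B
  proof unfold_locales
    show "2 * (\<epsilon> * r0) < r0" "0 < \<epsilon> * r0" using \<epsilon>(1,2) r0 by auto
    show "b j \<noteq> 0" for j
      using holomorphic_injective_imp_regular[OF hol[of j] open_ball inj_on_branch[OF pole[of j]], of 0] r0 der[of j] by auto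
    show "norm (b j) / 2 * dist u v \<le> dist (branch (a j) u) (branch (a j) v) \<and>
        dist (branch (a j) u) (branch (a j) v) \<le> 2 * norm (b j) * dist u v"
      if "norm u \<le> \<epsilon> * r0" "norm v \<le> \<epsilon> * r0" for j u v
      using \<epsilon>(3)[OF r0 hol inj_on_branch[OF pole] that] der by simp
  qed (fact assms(4) B a_lim)+
  note summ = summable_pole_series_iff[OF assms(7) _ assms(8,9), folded d_def]
  have upper: "\<exists>R0. \<forall>R\<ge>R0. hausdorff_measure s (large_orbit_set R f) = 0" if "s > d" for s
    using hausdorff_null_large_orbit_set[of s] summ[of s] that d by auto
  \<comment> \<open>A single set inside both the escaping set and the large orbit set gives both
    lower bounds, for every \<open>R\<close>; only the upper bounds require large
    \<open>R\<close>.\<close>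
  have lower: "hausdorff_measure s (escaping_set f \<inter> large_orbit_set R f) \<noteq> 0" if "0 < s" "s < d" for s R
    using hausdorff_measure_escaping_nonzero[of s R] summ[of s] that by auto
  have ge_J: "ereal d \<le> hausdorff_dim (large_orbit_set R f)" for R
    using lower hausdorff_null_subset by (intro hausdorff_dim_ge) blast
  have ge_I: "ereal d \<le> hausdorff_dim (escaping_set f)"
    using lower hausdorff_null_subset by (intro hausdorff_dim_ge) blast
  have le_J: "\<exists>R0. \<forall>R\<ge>R0. hausdorff_dim (large_orbit_set R f) \<le> ereal s" if "s > d" for s
    using upper[OF that] hausdorff_dim_le[of s] that d by (meson less_imp_le less_trans)
  \<comment> \<open>The escaping set does not depend on \<open>R\<close>, so for each
    \<open>s\<close> any \<open>R\<close> beyond the threshold in \<open>upper\<close>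
    serves.\<close>
  have le_I: "hausdorff_dim (escaping_set f) \<le> ereal s" if "s > d" for s
    using upper[OF that] hausdorff_null_escaping_set[of s] that d
    by (intro hausdorff_dim_le) (auto intro: order_trans)
  have "hausdorff_dim (escaping_set f) \<le> ereal d"
    by (rule ereal_le_epsilon2) (use le_I[of "d + _"] in auto)
  then have "hausdorff_dim (escaping_set f) = ereal d" using ge_I by (rule antisym)
  moreover have "((\<lambda>R. hausdorff_dim (large_orbit_set R f)) \<longlongrightarrow> ereal d) at_top"
  proof (rule order_tendstoI)
    show "\<forall>\<^sub>F R in at_top. y < hausdorff_dim (large_orbit_set R f)" if "y < ereal d" for y
      using less_le_trans[OF that ge_J] by simp
    show "\<forall>\<^sub>F R in at_top. hausdorff_dim (large_orbit_set R f) < y" if y: "ereal d < y" for y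
    proof -
      obtain s where s: "ereal d < ereal s" "ereal s < y" using ereal_dense2[OF y] by blast
      then obtain R0 where "\<And>R. R \<ge> R0 \<Longrightarrow> hausdorff_dim (large_orbit_set R f) \<le> ereal s"
        using le_J[of s] by auto
      then show ?thesis using s(2) unfolding eventually_at_top_linorder by (meson le_less_trans)
    qed
  qed
  ultimately show ?thesis by (simp add: d_def)
qed

end
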